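(* Let $m,n\ge1$, let $\|\cdot\|$ be a differentiable, strictly convex, non-Euclidean norm on $\mathbb{R}^2$, and let $\mathcal{G}(\mathcal{B})$ be the braced framework obtained from an irregularly spaced $m\times n$ grid framework $\mathcal{G}$, aligned with the coordinate axes, and a set $\mathcal{B}\subseteq\mathcal{B}_{\rm max}$ of diagonal braces. Then the following are equivalent. (i) $\mathcal{G}(\mathcal{B})$ is infinitesimally rigid in $(\mathbb{R}^2,\|\cdot\|)$. (ii) $\mathcal{G}(\mathcal{B}_{\rm max})$ is infinitesimally rigid in $(\mathbb{R}^2,\|\cdot\|)$, and the bicoloured braces graph of $\mathcal{G}(\mathcal{B})$ is a spanning subgraph of $K^2_{m,n}$ with an independent cycle in each path-connected component, where a cycle $c$ is independent if its gain satisfies $\gamma(c)\neq 1$.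
   Context: Norms. A norm on $\mathbb{R}^2$ is differentiable if it is differentiable away from $0$. It is non-Euclidean if it is not induced by an inner product. Frameworks. A bar-joint framework $(G,p)$ in $\mathbb{R}^2$ is a simple graph $G=(V,E)$ with a placement $p:V\to\mathbb{R}^2$, $v_i\mapsto p_i$. An infinitesimal flex with respect to $\|\cdot\|$ is an assignment of vectors $u_i\in\mathbb{R}^2$ to the vertices with $\|(p_i+tu_i)-(p_j+tu_j)\|-\|p_i-p_j\|=o(t)$ as $t\to 0+$ for each edge $v_iv_j$. A rigid motion flex of a framework is an infinitesimal flex which extends to an infinitesimal flex of every framework containing it (for a non-Euclidean norm these are exactly the translation flexes). A framework is infinitesimally rigid in $(\mathbb{R}^2,\|\cdot\|)$ if all its infinitesimal flexes are rigid motion flexes. Grids. An irregularly spaced, axis-aligned $m\times n$ grid framework has joints $(x_j,y_k)$, $0\le j\le m$, $0\le k\le n$, for some reals $x_0<\dots<x_m$ and $y_0<\dots<y_n$, and bars joining $(x_j,y_k)$ to $(x_{j+1},y_k)$ and $(x_j,y_k)$ to $(x_j,y_{k+1})$. Each of the $mn$ rectangular cells has two possible diagonal braces, and $\mathcal{B}_{\rm max}$ is the set of all $2mn$ of them. $\mathcal{G}(\mathcal{B})$ is obtained by adding the braces in $\mathcal{B}$ as bars (crossing braces are not joined where they cross). Braces graph. $K^2_{m,n}$ is the multigraph obtained from the complete bipartite graph $K_{m,n}$, with vertices $v_1,\dots,v_m$ (the columns of cells) and $w_1,\dots,w_n$ (the rows of cells), by doubling each edge, one copy blue and one red. The edge $v_jw_k$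 corresponds to the cell in column $j$ and row $k$. Blue edges correspond to the braces of negative slope and red edges to the braces of positive slope. The bicoloured braces graph of $\mathcal{G}(\mathcal{B})$ is the subgraph of $K^2_{m,n}$ consisting of the edges corresponding to braces in $\mathcal{B}$ and their end vertices. It is spanning if every vertex of $K^2_{m,n}$ belongs to it. Cycles may have length 2 (the blue and the red edge between two vertices). Brace parameters. For nonzero $q\in\mathbb{R}^2$, the tangential direction at $q$ is the direction of the tangent line to the unit sphere of $\|\cdot\|$ at $q/\|q\|$. Let $u_x$ be the $\|\cdot\|$-unit vector with positive first coordinate in the tangential direction at $(0,1)$, and let $u_y$ be the $\|\cdot\|$-unit vector with positive second coordinate in the tangential direction at $(1,0)$. For a blue edge $e$, whose brace is parallel to $q$, the brace parameter $\lambda_e>0$ is the unique positive number such that $\lambda_e u_x+u_y$ is in the tangential direction at $q$. For a red edge $e$, whose brace is parallel to $q$, $\lambda_e>0$ is the unique positive number such that $-\lambda_e u_x+u_y$ is in the tangential direction at $q$. (These exist by strict convexity.) Gains. The gain of an edge $e$ of $K^2_{m,n}$ is $\gamma(e)=\lambda_e$ when $e$ is traversed from its $v$-vertex to its $w$-vertex, and $\lambda_e^{-1}$ when traversed in the opposite direction. The gain $\gamma(c)$ of a directed cycle $c$ is the product, in the multiplicative group $\mathbb{R}_+$ of positive reals, of the gains of its edges as traversed. The condition $\gamma(c)\ne1$ does not depend on the direction chosen. *)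

theory Defs
  imports "HOL-Analysis.Analysis" "HOL-Library.Landau_Symbols" "Graph_Theory.Digraph_Component"
begin

section \<open>Norms on the plane\<close>

definition norm_on_plane :: "(real^2 \<Rightarrow> real) \<Rightarrow> bool" where
  "norm_on_plane N \<longleftrightarrow>
     (\<forall>v. 0 \<le> N v) \<and>
     (\<forall>v. N v = 0 \<longleftrightarrow> v = 0) \<and>
     (\<forall>a v. N (a *\<^sub>R v) = \<bar>a\<bar> * N v) \<and>
     (\<forall>v w. N (v + w) \<le> N v + N w)"

definition differentiable_norm :: "(real^2 \<Rightarrow> real) \<Rightarrow> bool" where
  "differentiable_norm N \<longleftrightarrow> (\<forall>v. v \<noteq> 0 \<longrightarrow> N differentiable (at v))"

definition strictly_convex_norm :: "(real^2 \<Rightarrow> real) \<Rightarrow> bool" where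
  "strictly_convex_norm N \<longleftrightarrow>
     (\<forall>v w. N v = 1 \<and> N w = 1 \<and> v \<noteq> w \<longrightarrow> (\<forall>z\<in>open_segment v w. N z < 1))"

definition inner_product_on_plane :: "(real^2 \<Rightarrow> real^2 \<Rightarrow> real) \<Rightarrow> bool" where
  "inner_product_on_plane b \<longleftrightarrow>
     bilinear b \<and> (\<forall>v w. b v w = b w v) \<and> (\<forall>v. v \<noteq> 0 \<longrightarrow> 0 < b v v)"

definition euclidean_norm :: "(real^2 \<Rightarrow> real) \<Rightarrow> bool" where
  "euclidean_norm N \<longleftrightarrow> (\<exists>b. inner_product_on_plane b \<and> (\<forall>v. N v = sqrt (b v v)))"

section \<open>Bar-joint frameworks\<close>

text \<open>The values of a placement, or of a flex, at indices that are not joints are irrelevant.\<close>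

record 'v framework =
  joints :: "'v set"
  bars :: "'v set set"
  placement :: "'v \<Rightarrow> real^2"

definition wf_framework :: "'v framework \<Rightarrow> bool" where
  "wf_framework F \<longleftrightarrow> (\<forall>e\<in>bars F. e \<subseteq> joints F \<and> card e = 2)"

definition contains_framework :: "'v framework \<Rightarrow> 'v framework \<Rightarrow> bool" where
  "contains_framework F' F \<longleftrightarrow>
     joints F \<subseteq> joints F' \<and> bars F \<subseteq> bars F' \<and> (\<forall>i\<in>joints F. placement F' i = placement F i)"

definition infinitesimal_flex ::
  "(real^2 \<Rightarrow> real) \<Rightarrow> 'v framework \<Rightarrow> ('v \<Rightarrow> real^2) \<Rightarrow> bool" where
  "infinitesimal_flex N F u \<longleftrightarrow>
     (\<forall>i j. {i, j} \<in> bars F \<longrightarrow>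
        (\<lambda>t. N ((placement F i + t *\<^sub>R u i) - (placement F j + t *\<^sub>R u j))
             - N (placement F i - placement F j))
        \<in> o[at_right 0](\<lambda>t. t))"

text \<open>
  The additional joints of a containing framework are drawn from the index type \<open>'v\<close>, so this
  notion is meant for infinite index types. For a finite framework indexed by \<open>nat \<times> nat\<close>, as
  below, all finite and countably infinite containing frameworks are covered, up to the naming
  of the additional joints.
\<close>

definition rigid_motion_flex ::
  "(real^2 \<Rightarrow> real) \<Rightarrow> 'v framework \<Rightarrow> ('v \<Rightarrow> real^2) \<Rightarrow> bool" where
  "rigid_motion_flex N F u \<longleftrightarrow>
     infinitesimal_flex N F u \<and>
     (\<forall>F'. wf_framework F' \<and> contains_framework F' F \<longrightarrow>
        (\<exists>u'. infinitesimal_flex N F' u' \<and> (\<forall>i\<in>joints F. u' i = u i)))"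

definition infinitesimally_rigid :: "(real^2 \<Rightarrow> real) \<Rightarrow> 'v framework \<Rightarrow> bool" where
  "infinitesimally_rigid N F \<longleftrightarrow>
     (\<forall>u. infinitesimal_flex N F u \<longrightarrow> rigid_motion_flex N F u)"

section \<open>Braced grids\<close>

text \<open>
  Cells are numbered from 0: the cell in column \<open>j\<close> and row \<open>k\<close> has lower left corner
  \<open>(x j, y k)\<close>. A brace is given by its column, its row and its colour, and the same
  triple serves as the corresponding edge of $K^2_{m,n}$.
\<close>

datatype colour = Blue | Red

type_synonym brace = "nat \<times> nat \<times> colour"

definition max_braces :: "nat \<Rightarrow> nat \<Rightarrow> brace set" where
  "max_braces m n = {..<m} \<times> {..<n} \<times> UNIV"

definition grid_bars :: "nat \<Rightarrow> nat \<Rightarrow> (nat \<times> nat) set set" where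
  "grid_bars m n =
     {{(j, k), (j + 1, k)} | j k. j < m \<and> k \<le> n} \<union>
     {{(j, k), (j, k + 1)} | j k. j \<le> m \<and> k < n}"

fun brace_bar :: "brace \<Rightarrow> (nat \<times> nat) set" where
  "brace_bar (j, k, Blue) = {(j, k + 1), (j + 1, k)}"
| "brace_bar (j, k, Red) = {(j, k), (j + 1, k + 1)}"

definition braced_grid ::
  "nat \<Rightarrow> nat \<Rightarrow> (nat \<Rightarrow> real) \<Rightarrow> (nat \<Rightarrow> real) \<Rightarrow> brace set \<Rightarrow> (nat \<times> nat) framework" where
  "braced_grid m n x y B =
     \<lparr> joints = {0..m} \<times> {0..n},
       bars = grid_bars m n \<union> brace_bar ` B,
       placement = (\<lambda>(j, k). vector [x j, y k]) \<rparr>"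

section \<open>Brace parameters\<close>

text \<open>The tangent line to the level set \<open>N v = 1\<close> is parallel to the kernel of the derivative.\<close>

definition tangential :: "(real^2 \<Rightarrow> real) \<Rightarrow> real^2 \<Rightarrow> real^2 \<Rightarrow> bool" where
  "tangential N q d \<longleftrightarrow> d \<noteq> 0 \<and> frechet_derivative N (at (q /\<^sub>R N q)) d = 0"

definition tangent_x :: "(real^2 \<Rightarrow> real) \<Rightarrow> real^2" where
  "tangent_x N = (THE u. N u = 1 \<and> 0 < u $ 1 \<and> tangential N (vector [0, 1]) u)"

definition tangent_y :: "(real^2 \<Rightarrow> real) \<Rightarrow> real^2" where
  "tangent_y N = (THE u. N u = 1 \<and> 0 < u $ 2 \<and> tangential N (vector [1, 0]) u)"

fun brace_vector :: "(nat \<Rightarrow> real) \<Rightarrow> (nat \<Rightarrow> real) \<Rightarrow> brace \<Rightarrow> real^2" where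
  "brace_vector x y (j, k, Blue) = vector [x (j + 1) - x j, - (y (k + 1) - y k)]"
| "brace_vector x y (j, k, Red) = vector [x (j + 1) - x j, y (k + 1) - y k]"

fun colour_sign :: "brace \<Rightarrow> real" where
  "colour_sign (j, k, Blue) = 1"
| "colour_sign (j, k, Red) = - 1"

definition brace_parameter ::
  "(real^2 \<Rightarrow> real) \<Rightarrow> (nat \<Rightarrow> real) \<Rightarrow> (nat \<Rightarrow> real) \<Rightarrow> brace \<Rightarrow> real" where
  "brace_parameter N x y e =
     (THE l. 0 < l \<and>
        tangential N (brace_vector x y e) ((colour_sign e * l) *\<^sub>R tangent_x N + tangent_y N))"

section \<open>Bicoloured braces graphs\<close>

text \<open>
  Undirected multigraphs are encoded as digraphs having, for every edge \<open>e\<close>, one arc \<open>VW e\<close>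
  from its v-vertex (column) to its w-vertex (row) and one arc \<open>WV e\<close> back. Strongly connected
  components are then the path-connected components, and a directed cycle of the multigraph is a
  cycle of the digraph that uses no edge twice (excluding \<open>[VW e, WV e]\<close>).
\<close>

datatype braces_vertex = Col nat | Row nat

datatype braces_arc = VW (arc_edge: brace) | WV (arc_edge: brace)

fun braces_tail :: "braces_arc \<Rightarrow> braces_vertex" where
  "braces_tail (VW (j, k, c)) = Col j"
| "braces_tail (WV (j, k, c)) = Row k"

fun braces_head :: "braces_arc \<Rightarrow> braces_vertex" where
  "braces_head (VW (j, k, c)) = Row k"
| "braces_head (WV (j, k, c)) = Col j"

definition doubled_complete_bipartite :: "nat \<Rightarrow> nat \<Rightarrow> (braces_vertex, braces_arc) pre_digraph" where
  "doubled_complete_bipartite m n =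
     \<lparr> verts = Col ` {..<m} \<union> Row ` {..<n},
       arcs = {a. arc_edge a \<in> max_braces m n},
       tail = braces_tail, head = braces_head \<rparr>"

definition braces_graph :: "brace set \<Rightarrow> (braces_vertex, braces_arc) pre_digraph" where
  "braces_graph B =
     \<lparr> verts = (\<Union>(j, k, c)\<in>B. {Col j, Row k}),
       arcs = {a. arc_edge a \<in> B},
       tail = braces_tail, head = braces_head \<rparr>"

definition multigraph_cycle :: "(braces_vertex, braces_arc) pre_digraph \<Rightarrow> braces_arc list \<Rightarrow> bool" where
  "multigraph_cycle G c \<longleftrightarrow> pre_digraph.cycle G c \<and> distinct (map arc_edge c)"

fun gain :: "(brace \<Rightarrow> real) \<Rightarrow> braces_arc \<Rightarrow> real" where
  "gain l (VW e) = l e"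
| "gain l (WV e) = inverse (l e)"

definition cycle_gain :: "(brace \<Rightarrow> real) \<Rightarrow> braces_arc list \<Rightarrow> real" where
  "cycle_gain l c = prod_list (map (gain l) c)"

definition independent_cycle ::
  "(brace \<Rightarrow> real) \<Rightarrow> (braces_vertex, braces_arc) pre_digraph \<Rightarrow> braces_arc list \<Rightarrow> bool" where
  "independent_cycle l G c \<longleftrightarrow> multigraph_cycle G c \<and> cycle_gain l c \<noteq> 1"

end

(*
  A flex of the unbraced grid moves neighbouring joints of a horizontal (vertical) bar apart by a
  multiple of u_y (u_x), and closing up around the cells makes these multiples depend only on the
  column j (a_j) resp. the row k (- b_k). A brace e in cell (j, k) imposes b_k = lambda_e a_j.
  So modulo translations the flexes of G(B) are the functions on the vertices of K_{m,n}
  that are multiplied by the gain along every edge of the braces graph; they all vanish iff every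
  vertex is on a brace and every component carries a cycle of gain different from 1.

  It remains to see that a rigid motion flex is a translation, although rigid motions are only
  defined by extendability. For the complete set of braces a nonzero (a, b) has no zero entries.
  Extending the flex to the complete framework on a lattice gives, by closing up around
  parallelograms, an injective linear map L with L p tangential at p for all lattice vectors p,
  hence by convexity for all p. As L p is never a multiple of p, the eigenvalues of L are not real, and
  N is constant along the flow of L. So the eigenvalues are imaginary, the orbits of the flow are
  ellipses, and N is Euclidean.
*)
theory Submission
  imports Defs
begin

section \<open>Gain graphs\<close>

lemma cycle_gain_simps [simp]:
  "cycle_gain l [] = 1"
  "cycle_gain l (a # p) = gain l a * cycle_gain l p"
  "cycle_gain l (p @ q) = cycle_gain l p * cycle_gain l q"
  by (simp_all add: cycle_gain_def)

text \<open>A vertex without a brace is left unconstrained. This freedom is why the vanishing of all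
  potentials forces the braces graph to be spanning.\<close>

definition potential :: "(brace \<Rightarrow> real) \<Rightarrow> brace set \<Rightarrow> (braces_vertex \<Rightarrow> real) \<Rightarrow> bool" where
  "potential l B f \<longleftrightarrow> (\<forall>j k c. (j, k, c) \<in> B \<longrightarrow> f (Row k) = l (j, k, c) * f (Col j))"

text \<open>An edge carries only the arcs \<open>VW\<close> and \<open>WV\<close>, so two distinct
  arcs over one edge are reverses of each other. The product of gains is kept unsimplified because
  \<open>l\<close> may vanish here.\<close>

lemma braces_ends_eq:
  assumes "arc_edge a = arc_edge b" "a \<noteq> b"
  shows "braces_tail a = braces_head b" "braces_head a = braces_tail b"
    "gain l a * gain l b = l (arc_edge a) * inverse (l (arc_edge a))"
  using assms by (cases a; cases b; auto)+

text \<open>Names the vertex of the split by the tail of \<open>a\<close> rather than by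
  \<open>awlast\<close>, so that the ends of the pieces cut out of a closed walk can be
  compared.\<close>

lemma (in wf_digraph) awalk_append_Cons:
  "awalk u (p @ a # q) v \<longleftrightarrow> awalk u p (tail G a) \<and> a \<in> arcs G \<and> awalk (head G a) q v"
proof -
  have "awlast u p = tail G a" if "awalk u p (tail G a)" using that by auto
  then show ?thesis
    by (auto simp: awalk_Cons_iff)
qed

lemma not_distinct_map_decomp:
  assumes "\<not> distinct (map f p)"
  shows "\<exists>p1 a p2 b p3. p = p1 @ a # p2 @ b # p3 \<and> f a = f b"
proof -
  obtain xs ys zs z where "map f p = xs @ [z] @ ys @ [z] @ zs"
    using not_distinct_decomp[OF assms] by blast
  then show ?thesis
    by (fastforce simp: map_eq_append_conv append_eq_map_conv Cons_eq_map_conv)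
qed

lemma closed_walk_imp_independent_cycle:
  assumes wf: "wf_digraph H" and ht: "head H = braces_head" "tail H = braces_tail"
    and pos: "\<And>a. a \<in> arcs H \<Longrightarrow> 0 < l (arc_edge a)"
    and walk: "pre_digraph.awalk H u p u" "cycle_gain l p \<noteq> 1"
  shows "\<exists>c. independent_cycle l H c"
  using walk
proof (induction "length p" arbitrary: u p rule: less_induct)
  case less
  interpret wf_digraph H by (rule wf)
  (* At a repeated vertex or edge the walk splits into two shorter closed walks, one of which has
     gain different from 1. *)
  have shorten: ?thesis
    if "awalk v q v" "awalk w r w" "length q < length p" "length r < length p"
      "cycle_gain l p = cycle_gain l q * cycle_gain l r" for v w q r
    using less.hyps[OF that(3,1)] less.hyps[OF that(4,2)] less.prems(2) that(5) by fastforce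
  show ?case
  proof (cases "distinct (map (head H) p) \<and> distinct (map arc_edge p)")
    case True
    \<comment> \<open>\<open>cycle\<close> asks for distinctness of the visited vertices without the
      first one, and these are the heads of the arcs.\<close>
    moreover have "tl (awalk_verts u p) = map (head H) p" if "p \<noteq> []"
      using awalk_verts_conv'[of u p u] less.prems(1) that by auto
    moreover have "p \<noteq> []" using less.prems(2) by auto
    ultimately have "independent_cycle l H p"
      using less.prems unfolding independent_cycle_def multigraph_cycle_def cycle_def by auto
    then show ?thesis by blast
  next
    case False
    show ?thesis
    proof (cases "\<exists>p1 a p2 b p3. p = p1 @ a # p2 @ b # p3 \<and> head H a = head H b")
      case True
      then obtain p1 a p2 b p3 where p: "p = p1 @ a # p2 @ b # p3" "head H a = head H b" by blast
      show ?thesis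
      proof (rule shorten)
        show "awalk (head H a) (p2 @ [b]) (head H a)" "awalk u (p1 @ a # p3) u"
          using less.prems(1) p
          by (auto simp: awalk_append_Cons awalk_Nil_iff simp del: awalk_append_iff)
      qed (use p in auto)
    next
      case False
      then obtain p1 a p2 b p3 where p: "p = p1 @ a # p2 @ b # p3" "arc_edge a = arc_edge b"
        using not_distinct_map_decomp[of "head H" p] not_distinct_map_decomp[of arc_edge p] \<open>\<not> (_ \<and> _)\<close> by metis
      \<comment> \<open>With no head repeated, \<open>a\<close> and \<open>b\<close> must be the two
        opposite arcs of one edge. Then \<open>p2\<close> is closed at the head of \<open>a\<close>,
        and deleting both arcs joins \<open>p1\<close> to \<open>p3\<close> and removes only the
        factor 1 from the gain.\<close>
      with False have ab: "a \<noteq> b" by blast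
      have arcs: "a \<in> arcs H" using less.prems(1) p by (auto simp: awalk_append_Cons simp del: awalk_append_iff)
      note e = braces_ends_eq[OF p(2) ab]
      show ?thesis
      proof (rule shorten)
        show "awalk (head H a) p2 (head H a)"
          using less.prems(1) p(1) e unfolding ht
          by (auto simp: awalk_append_Cons ht simp del: awalk_append_iff)
        have "awalk u p1 (tail H a)" "awalk (tail H a) p3 u"
          using less.prems(1) p(1) e unfolding ht
          by (auto simp: awalk_append_Cons ht simp del: awalk_append_iff)
        then show "awalk u (p1 @ p3) u" by (rule awalk_appendI)
        have "gain l a * gain l b = 1" using e(3)[of l] pos[OF arcs] by simp
        then show "cycle_gain l p = cycle_gain l p2 * cycle_gain l (p1 @ p3)"
          by (simp add: p(1) mult.left_commute mult.assoc)
      qed (use p in auto)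
    qed
  qed
qed

section \<open>Potentials and the components of the braces graph\<close>

lemma potential_along_walk:
  assumes wf: "wf_digraph H" and ht: "head H = braces_head" "tail H = braces_tail"
    and "potential l B f" and "\<And>a. a \<in> arcs H \<Longrightarrow> arc_edge a \<in> B"
    and pos: "\<And>e. e \<in> B \<Longrightarrow> 0 < l e"
    and "pre_digraph.awalk H u p v"
  shows "f v = cycle_gain l p * f u"
  using assms(7)
proof (induction p arbitrary: u)
  case Nil
  then show ?case by (simp add: pre_digraph.awalk_def pre_digraph.cas.simps)
next
  case (Cons a p)
  interpret wf_digraph H by (rule wf)
  from Cons.prems have a: "a \<in> arcs H" "tail H a = u" "awalk (head H a) p v"
    by (auto simp: awalk_Cons_iff)
  have "f (head H a) = gain l a * f u"
    using a assms(4) assms(5)[OF a(1)] pos[OF assms(5)[OF a(1)]]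
    unfolding ht potential_def by (cases a; cases "arc_edge a") (auto simp: field_simps)
  with Cons.IH[OF a(3)] show ?case by simp
qed

lemma wf_braces_graph: "wf_digraph (braces_graph B)"
proof
  fix a assume "a \<in> arcs (braces_graph B)"
  then show "tail (braces_graph B) a \<in> verts (braces_graph B)"
    "head (braces_graph B) a \<in> verts (braces_graph B)"
    by (cases a; cases "arc_edge a"; force simp: braces_graph_def)+
qed

lemma wf_doubled_complete_bipartite: "wf_digraph (doubled_complete_bipartite m n)"
proof
  fix a assume "a \<in> arcs (doubled_complete_bipartite m n)"
  then show "tail (doubled_complete_bipartite m n) a \<in> verts (doubled_complete_bipartite m n)"
    "head (doubled_complete_bipartite m n) a \<in> verts (doubled_complete_bipartite m n)"
    by (cases a; cases "arc_edge a"; force simp: doubled_complete_bipartite_def max_braces_def)+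
qed

text \<open>For a set of braces of the grid, the subgraph condition inside \<open>spanning\<close>
  holds automatically; only the vertex sets remain to be compared.\<close>

lemma spanning_braces_graph_iff:
  assumes "B \<subseteq> max_braces m n"
  shows "spanning (braces_graph B) (doubled_complete_bipartite m n) \<longleftrightarrow>
    verts (doubled_complete_bipartite m n) \<subseteq> verts (braces_graph B)"
proof -
  have "subgraph (braces_graph B) (doubled_complete_bipartite m n)"
    using assms wf_braces_graph wf_doubled_complete_bipartite
    by (auto simp: subgraph_def compatible_def)
      (auto simp: braces_graph_def doubled_complete_bipartite_def max_braces_def)
  then show ?thesis by (auto simp: spanning_def subgraph_def)
qed

lemma scc_of_braces_graph:
  assumes "H \<in> pre_digraph.sccs (braces_graph B)"
  shows "wf_digraph H" "head H = braces_head" "tail H = braces_tail"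
    "arcs H = {a. arc_edge a \<in> B \<and> braces_tail a \<in> verts H \<and> braces_head a \<in> verts H}"
    "strongly_connected H"
  using assms
  by (auto simp: pre_digraph.sccs_def induced_subgraph_def subgraph_def compatible_def braces_graph_def)

text \<open>Going once around an independent cycle multiplies the value at its base point by a
  number other than 1, so that value is 0. Strong connectedness carries the 0 through the component,
  and by spanning every vertex lies in a component.\<close>

lemma potential_eq_0:
  assumes B: "B \<subseteq> max_braces m n" and pos: "\<And>e. e \<in> B \<Longrightarrow> 0 < l e"
    and sp: "spanning (braces_graph B) (doubled_complete_bipartite m n)"
    and cyc: "\<forall>H \<in> pre_digraph.sccs (braces_graph B). \<exists>c. independent_cycle l H c"
    and f: "potential l B f"
    and v: "v \<in> verts (doubled_complete_bipartite m n)"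
  shows "f v = 0"
proof -
  interpret G: wf_digraph "braces_graph B" by (rule wf_braces_graph)
  have "v \<in> verts (braces_graph B)" using sp v spanning_braces_graph_iff[OF B] by auto
  then have "v \<in> G.scc_of v" "G.scc_of v \<in> G.sccs_verts"
    by (simp_all add: G.in_scc_of_self G.scc_of_in_sccs_verts)
  then obtain H where H: "H \<in> G.sccs" "v \<in> verts H"
    unfolding G.sccs_verts_conv by auto
  note scc = scc_of_braces_graph[OF H(1)]
  interpret H: wf_digraph H by (rule scc(1))
  have walk: "f w = cycle_gain l p * f u" if "H.awalk u p w" for u p w
    by (rule potential_along_walk[OF scc(1-3) f]) (use scc(4) pos that in auto)
  obtain c where "independent_cycle l H c" using cyc H(1) by blast
  then obtain u where u: "H.awalk u c u" "cycle_gain l c \<noteq> 1"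
    unfolding independent_cycle_def multigraph_cycle_def H.cycle_def by blast
  then have "f u = 0" using walk[OF u(1)] by auto
  moreover have "u \<rightarrow>\<^sup>*\<^bsub>H\<^esub> v"
    using scc(5) H(2) u(1) H.awalk_hd_in_verts unfolding strongly_connected_def by blast
  ultimately show ?thesis using walk by (auto simp: H.reachable_awalk)
qed

text \<open>The indicator function of a vertex that meets no brace would be a nonzero
  potential.\<close>

lemma spanning_if_potentials_eq_0:
  assumes B: "B \<subseteq> max_braces m n"
    and zero: "\<And>f v. potential l B f \<Longrightarrow> v \<in> verts (doubled_complete_bipartite m n) \<Longrightarrow> f v = 0"
  shows "spanning (braces_graph B) (doubled_complete_bipartite m n)"
  unfolding spanning_braces_graph_iff[OF B]
proof
  fix v assume v: "v \<in> verts (doubled_complete_bipartite m n)"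
  show "v \<in> verts (braces_graph B)"
  proof (rule ccontr)
    assume nv: "v \<notin> verts (braces_graph B)"
    have "potential l B (\<lambda>w. if w = v then 1 else 0)"
      using nv by (force simp: potential_def braces_graph_def)
    from zero[OF this v] show False by simp
  qed
qed

text \<open>If \<open>H\<close> had no independent cycle, all its closed walks would have gain 1.
  The gain of a walk from a root \<open>r\<close> would then depend on its end only, since two such
  walks can be closed by the same way back. These gains, extended by 0 outside \<open>H\<close>,
  form a potential with value 1 at \<open>r\<close>.\<close>

lemma independent_cycle_if_potentials_eq_0:
  assumes B: "B \<subseteq> max_braces m n" and pos: "\<And>e. e \<in> B \<Longrightarrow> 0 < l e"
    and zero: "\<And>f v. potential l B f \<Longrightarrow> v \<in> verts (doubled_complete_bipartite m n) \<Longrightarrow> f v = 0"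
    and H: "H \<in> pre_digraph.sccs (braces_graph B)"
  shows "\<exists>c. independent_cycle l H c"
proof (rule ccontr)
  assume no: "\<nexists>c. independent_cycle l H c"
  note scc = scc_of_braces_graph[OF H]
  interpret G: wf_digraph "braces_graph B" by (rule wf_braces_graph)
  interpret H: wf_digraph H by (rule scc(1))
  have "0 < l (arc_edge a)" if "a \<in> arcs H" for a
    using that scc(4) pos by blast
  then have closed: "cycle_gain l p = 1" if "H.awalk u p u" for u p
    using closed_walk_imp_independent_cycle[OF scc(1-3) _ that, of l] no by blast
  have HS: "verts H \<in> G.sccs_verts" using H by (rule G.in_sccs_vertsI_sccs[OF imageI])
  obtain r where r: "r \<in> verts H" using scc(5) by (auto simp: strongly_connected_def)
  have sc: "\<exists>p. H.awalk u p v" if "u \<in> verts H" "v \<in> verts H" for u v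
    using scc(5) that by (auto simp: strongly_connected_def H.reachable_awalk)
  define P where "P v = (SOME p. H.awalk r p v)" for v
  have P: "H.awalk r (P v) v" if "v \<in> verts H" for v
    unfolding P_def using someI_ex[OF sc[OF r that]] .
  have uniq: "cycle_gain l p = cycle_gain l q" if "H.awalk r p v" "H.awalk r q v" for p q v
  proof -
    have "v \<in> verts H" using that(1) by auto
    then obtain s where s: "H.awalk v s r" using sc r by blast
    have "cycle_gain l (p @ s) = 1" "cycle_gain l (q @ s) = 1"
      using H.awalk_appendI[OF that(1) s] H.awalk_appendI[OF that(2) s] closed by blast+
    then show ?thesis by (metis cycle_gain_simps(3) mult_cancel_right mult_zero_right zero_neq_one)
  qed
  define f where "f v = (if v \<in> verts H then cycle_gain l (P v) else 0)" for v
  have "potential l B f"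
    unfolding potential_def
  proof (intro allI impI)
    fix j k c assume e: "(j, k, c) \<in> B"
    let ?a = "VW (j, k, c)" and ?b = "WV (j, k, c)"
    have "?a \<in> arcs (braces_graph B)" "?b \<in> arcs (braces_graph B)"
      using e by (auto simp: braces_graph_def)
    then have "Col j \<rightarrow>\<^sup>*\<^bsub>braces_graph B\<^esub> Row k" "Row k \<rightarrow>\<^sup>*\<^bsub>braces_graph B\<^esub> Col j"
      using G.reachable_adjI[OF G.in_arcs_imp_in_arcs_ends, of ?a]
        G.reachable_adjI[OF G.in_arcs_imp_in_arcs_ends, of ?b]
      by (simp_all add: braces_graph_def)
    \<comment> \<open>No brace edge leaves a component, so the extension by 0 does not violate the
      condition at any edge.\<close>
    then have iff: "Col j \<in> verts H \<longleftrightarrow> Row k \<in> verts H"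
      using HS unfolding G.in_sccs_verts_conv_reachable by blast
    show "f (Row k) = l (j, k, c) * f (Col j)"
    proof (cases "Col j \<in> verts H")
      case True
      have "?a \<in> arcs H" using scc(4) e True iff by auto
      then have "H.awalk (Col j) [?a] (Row k)"
        using True iff scc(2,3) by (simp add: H.awalk_Cons_iff H.awalk_Nil_iff)
      then have "H.awalk r (P (Col j) @ [?a]) (Row k)" using P[OF True] by (rule H.awalk_appendI[rotated])
      from uniq[OF this P] True iff show ?thesis by (simp add: f_def mult.commute)
    qed (use iff in \<open>simp add: f_def\<close>)
  qed
  moreover have "r \<in> verts (doubled_complete_bipartite m n)"
    using r G.sccs_verts_subsets[OF HS] spanning_if_potentials_eq_0[OF B, of l] zero
    by (auto simp: spanning_def)
  ultimately have "f r = 0" by (rule zero)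
  moreover have "f r = 1" using closed[OF P[OF r]] r by (simp add: f_def)
  ultimately show False by simp
qed

section \<open>Differentiable strictly convex norms on the plane\<close>

lemma exhaust_basis:
  fixes a b v :: "real^2"
  assumes "a $ 1 * b $ 2 \<noteq> a $ 2 * b $ 1"
  obtains s r where "v = s *\<^sub>R a + r *\<^sub>R b"
proof -
  define d where "d = a $ 1 * b $ 2 - a $ 2 * b $ 1"
  have "d \<noteq> 0" using assms unfolding d_def by linarith
  \<comment> \<open>Cramer's rule with the denominator \<open>d\<close> cleared.\<close>
  have e: "(v $ 1 * b $ 2 - v $ 2 * b $ 1) * a $ 1 + (a $ 1 * v $ 2 - a $ 2 * v $ 1) * b $ 1 = v $ 1 * d"
    "(v $ 1 * b $ 2 - v $ 2 * b $ 1) * a $ 2 + (a $ 1 * v $ 2 - a $ 2 * v $ 1) * b $ 2 = v $ 2 * d"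
    unfolding d_def by algebra+
  have "v = ((v $ 1 * b $ 2 - v $ 2 * b $ 1) / d) *\<^sub>R a + ((a $ 1 * v $ 2 - a $ 2 * v $ 1) / d) *\<^sub>R b"
    unfolding vec_eq_iff forall_2 vector_add_component vector_scaleR_component real_scaleR_def
      times_divide_eq_left add_divide_distrib[symmetric] e
    using \<open>d \<noteq> 0\<close> by simp
  then show ?thesis by (rule that)
qed

lemma parallel_if_det_eq_0:
  fixes a b :: "real^2"
  assumes "a $ 1 * b $ 2 = a $ 2 * b $ 1" "a \<noteq> 0"
  obtains c where "b = c *\<^sub>R a"
proof (cases "a $ 1 = 0")
  case True
  with assms(2) have "a $ 2 \<noteq> 0" by (auto simp: vec_eq_iff forall_2)
  with True assms(1) have "b = (b $ 2 / a $ 2) *\<^sub>R a" by (simp add: vec_eq_iff forall_2)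
  then show ?thesis by (rule that)
next
  case False
  then have "b $ 2 = b $ 1 / a $ 1 * a $ 2" using assms(1) by (simp add: eq_divide_eq mult.commute)
  with False have "b = (b $ 1 / a $ 1) *\<^sub>R a" by (simp add: vec_eq_iff forall_2)
  then show ?thesis by (rule that)
qed

lemma exists_linear_kernel_vector:
  fixes f :: "real^2 \<Rightarrow> real"
  assumes "linear f"
  obtains d where "d \<noteq> 0" "f d = 0"
proof (cases "f (vector [1, 0]) = 0")
  case True
  then show ?thesis by (intro that[of "vector [1, 0]"]) (auto simp: vec_eq_iff forall_2)
next
  case False
  define d where "d = f (vector [0, 1]) *\<^sub>R vector [1, 0] - f (vector [1, 0]) *\<^sub>R (vector [0, 1] :: real^2)"
  have "f d = 0" unfolding d_def by (simp add: linear_diff linear_scale assms)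
  moreover have "d $ 2 \<noteq> 0" using False by (simp add: d_def)
  ultimately show ?thesis by (intro that[of d]) auto
qed

section \<open>The derivative of the norm and its kernel\<close>

locale plane_norm =
  fixes N :: "real^2 \<Rightarrow> real"
  assumes norm: "norm_on_plane N" and diff: "differentiable_norm N"
    and strict: "strictly_convex_norm N"
begin

abbreviation D :: "real^2 \<Rightarrow> real^2 \<Rightarrow> real" where
  "D p \<equiv> frechet_derivative N (at p)"

lemma N_nonneg [simp]: "0 \<le> N v"
  and N_eq_0_iff [simp]: "N v = 0 \<longleftrightarrow> v = 0"
  and N_scale: "N (a *\<^sub>R v) = \<bar>a\<bar> * N v"
  and N_triangle: "N (v + w) \<le> N v + N w"
  using norm by (auto simp: norm_on_plane_def)

lemma N_pos: "v \<noteq> 0 \<Longrightarrow> 0 < N v"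
  using N_nonneg[of v] N_eq_0_iff[of v] by linarith

lemma N_minus [simp]: "N (- v) = N v"
  using N_scale[of "-1" v] by simp

lemma has_derivative_N: "p \<noteq> 0 \<Longrightarrow> (N has_derivative D p) (at p)"
  using diff by (simp add: differentiable_norm_def frechet_derivative_works)

lemma linear_D: "p \<noteq> 0 \<Longrightarrow> linear (D p)"
  by (rule has_derivative_linear[OF has_derivative_N])

lemma D_line:
  assumes "p \<noteq> 0"
  shows "((\<lambda>t. N (p + t *\<^sub>R d)) has_real_derivative D p d) (at 0)"
proof -
  have "((\<lambda>t. N (p + t *\<^sub>R d)) has_derivative (\<lambda>t. D p (t *\<^sub>R d))) (at 0)"
    by (rule has_derivative_compose[of "\<lambda>t. p + t *\<^sub>R d" _ 0 UNIV N "D p", simplified])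
      (auto intro!: derivative_eq_intros simp: has_derivative_N assms)
  then show ?thesis
    by (simp add: has_field_derivative_def linear_scale[OF linear_D[OF assms]] mult_commute_abs)
qed

text \<open>By homogeneity both sides are derivatives at 0 of the same function,
  \<open>N (c *\<^sub>R p + t *\<^sub>R v)\<close>. Hence the spacing of the grid does not affect
  the conditions at horizontal and vertical bars.\<close>

lemma D_scale:
  assumes "p \<noteq> 0" "0 < c"
  shows "D (c *\<^sub>R p) = D p"
proof (rule ext)
  fix v
  have "((\<lambda>t. c * N (p + (t / c) *\<^sub>R v)) has_real_derivative c * (D p v * (1 / c))) (at 0)"
    by (rule DERIV_cmult, rule DERIV_chain2[of "\<lambda>t. N (p + t *\<^sub>R v)"])
      (use D_line[OF assms(1)] assms in \<open>auto intro!: derivative_eq_intros\<close>)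
  moreover have "(\<lambda>t. c * N (p + (t / c) *\<^sub>R v)) = (\<lambda>t. N (c *\<^sub>R p + t *\<^sub>R v))"
    using assms N_scale[of c "p + (t / c) *\<^sub>R v" for t] by (auto simp: scaleR_add_right fun_eq_iff)
  ultimately show "D (c *\<^sub>R p) v = D p v"
    using D_line[of "c *\<^sub>R p" v] assms by (auto dest: DERIV_unique)
qed

text \<open>Euler's identity for functions homogeneous of degree 1.\<close>

lemma D_self:
  assumes "p \<noteq> 0"
  shows "D p p = N p"
proof -
  have "((\<lambda>t. (1 + t) * N p) has_real_derivative N p) (at 0)"
    by (auto intro!: derivative_eq_intros)
  \<comment> \<open>The absolute value in the homogeneity of \<open>N\<close> disappears for
    \<open>t > - 1\<close>, which is enough near 0.\<close>
  moreover have "\<forall>\<^sub>F t in nhds 0. (1 + t) * N p = N (p + t *\<^sub>R p)"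
  proof -
    have "\<forall>\<^sub>F t in nhds (0::real). -1 < t"
      using eventually_nhds_in_open[of "{-1<..}" "0::real"] by auto
    then show ?thesis
    proof eventually_elim
      case (elim t)
      have "N (p + t *\<^sub>R p) = N ((1 + t) *\<^sub>R p)" by (simp add: algebra_simps)
      then show ?case using elim by (simp add: N_scale)
    qed
  qed
  ultimately have "((\<lambda>t. N (p + t *\<^sub>R p)) has_real_derivative N p) (at 0)"
    using DERIV_cong_ev[OF refl _ refl, of "\<lambda>t. (1 + t) * N p" "\<lambda>t. N (p + t *\<^sub>R p)" 0 "N p"] by simp
  then show ?thesis using D_line[OF assms, of p] by (auto dest: DERIV_unique)
qed

text \<open>The triangle inequality bounds each right difference quotient by \<open>N v\<close>; so
  \<open>D p\<close> has dual norm at most 1.\<close>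

lemma D_le:
  assumes "p \<noteq> 0"
  shows "D p v \<le> N v"
proof (rule tendsto_upperbound)
  show "((\<lambda>t. (N (p + t *\<^sub>R v) - N p) / t) \<longlongrightarrow> D p v) (at_right 0)"
    using D_line[OF assms, of v] by (auto simp: has_field_derivative_iff intro: tendsto_within_subset)
  show "\<forall>\<^sub>F t in at_right 0. (N (p + t *\<^sub>R v) - N p) / t \<le> N v"
    unfolding eventually_at_filter
  proof (intro always_eventually allI impI)
    fix t :: real assume "t \<noteq> 0" "t \<in> {0<..}"
    then show "(N (p + t *\<^sub>R v) - N p) / t \<le> N v"
      using N_triangle[of p "t *\<^sub>R v"] by (simp add: N_scale field_simps)
  qed
qed simp

lemma D_minus_left:
  assumes "p \<noteq> 0"
  shows "D (- p) v = - D p v"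
proof -
  have "((\<lambda>t. N (p + t *\<^sub>R (- v))) has_real_derivative D p (- v)) (at 0)"
    by (rule D_line[OF assms])
  moreover have "N (p + t *\<^sub>R (- v)) = N (- p + t *\<^sub>R v)" for t
    using N_minus[of "p + t *\<^sub>R (- v)"] by simp
  ultimately have "D p (- v) = D (- p) v"
    using D_line[of "- p" v] assms by (auto dest: DERIV_unique)
  then show ?thesis using linear_neg[OF linear_D[OF assms]] by simp
qed

text \<open>\<open>D p\<close> takes the value 1 at the normalised vectors \<open>p'\<close> and
  \<open>v'\<close>, hence also at their midpoint. If they differed, strict convexity would put the
  midpoint inside the open unit ball, where \<open>D p\<close> is below 1.\<close>

lemma parallel_if_D_eq_N:
  assumes "p \<noteq> 0" "v \<noteq> 0" "D p v = N v"
  shows "\<exists>c. v = c *\<^sub>R p"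
proof -
  define p' v' where "p' = p /\<^sub>R N p" and "v' = v /\<^sub>R N v"
  have N1: "N p' = 1" "N v' = 1"
    using assms N_pos[of p] N_pos[of v] by (auto simp: p'_def v'_def N_scale)
  have "D p p' = 1" "D p v' = 1"
    using assms N_pos[of p] N_pos[of v] D_self[OF assms(1)] linear_scale[OF linear_D[OF assms(1)]]
    by (auto simp: p'_def v'_def)
  then have D1: "D p (midpoint p' v') = 1"
    by (simp add: midpoint_def linear_scale linear_add linear_D assms(1))
  have "p' = v'"
  proof (rule ccontr)
    assume "p' \<noteq> v'"
    then have "N (midpoint p' v') < 1"
      using strict N1 by (auto simp: strictly_convex_norm_def)
    with D1 D_le[OF assms(1), of "midpoint p' v'"] show False by simp
  qed
  then have "N v *\<^sub>R p' = v" using assms(2) by (simp add: v'_def)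
  then have "v = (N v / N p) *\<^sub>R p" by (simp add: p'_def divide_inverse)
  then show ?thesis by blast
qed

lemma abs_D_le: "p \<noteq> 0 \<Longrightarrow> \<bar>D p v\<bar> \<le> N v"
  using D_le[of p v] D_le[of p "- v"] linear_neg[OF linear_D[of p], of v] by auto

text \<open>Expand \<open>d\<close> in the basis \<open>p\<close>, \<open>q\<close> if these are not
  parallel. Tangency gives two equations for the coefficients. They are incompatible with the strict
  bound \<open>\<bar>D p q\<bar> < N q\<close>, which comes from strict convexity, together with
  \<open>\<bar>D q p\<bar> \<le> N p\<close>, unless both coefficients vanish.\<close>

lemma parallel_if_common_tangent:
  assumes "p \<noteq> 0" "q \<noteq> 0" "d \<noteq> 0" "D p d = 0" "D q d = 0"
  shows "p $ 1 * q $ 2 = p $ 2 * q $ 1"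
proof (rule ccontr)
  assume nonpar: "p $ 1 * q $ 2 \<noteq> p $ 2 * q $ 1"
  note lin = linear_D[OF assms(1)] linear_D[OF assms(2)]
  note lins = linear_add[OF lin(1)] linear_scale[OF lin(1)] linear_add[OF lin(2)] linear_scale[OF lin(2)]
  obtain s r where sr: "d = s *\<^sub>R p + r *\<^sub>R q" using exhaust_basis[OF nonpar] .
  have eqs: "s * N p + r * D p q = 0" "s * D q p + r * N q = 0"
    using assms(4,5) D_self assms(1,2) by (auto simp: sr lins)
  have strictly: "\<bar>D p q\<bar> < N q"
  proof -
    have "D p q \<noteq> N q"
      using parallel_if_D_eq_N[of p q] nonpar assms(1,2) by auto
    moreover have "D p (- q) \<noteq> N (- q)"
    proof
      assume "D p (- q) = N (- q)"
      then obtain c where c: "- q = c *\<^sub>R p" using parallel_if_D_eq_N[of p "- q"] assms(1,2) by auto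
      have "q $ i = - (c * p $ i)" for i using arg_cong[OF c, of "\<lambda>v. v $ i"] by simp
      with nonpar show False by simp
    qed
    ultimately show ?thesis using abs_D_le[OF assms(1), of q] linear_neg[OF lin(1), of q] by auto
  qed
  have "\<bar>s * N p\<bar> = \<bar>r * D p q\<bar>" "\<bar>r * N q\<bar> = \<bar>s * D q p\<bar>"
    using eqs by linarith+
  then have "\<bar>s\<bar> * N p = \<bar>r\<bar> * \<bar>D p q\<bar>" "\<bar>r\<bar> * N q = \<bar>s\<bar> * \<bar>D q p\<bar>"
    by (simp_all add: abs_mult)
  moreover have "\<bar>s\<bar> * \<bar>D q p\<bar> \<le> \<bar>s\<bar> * N p"
    by (intro mult_left_mono abs_D_le assms) auto
  ultimately have "\<bar>r\<bar> * N q \<le> \<bar>r\<bar> * \<bar>D p q\<bar>" by simp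
  with strictly have "r = 0" by (smt (verit) mult_less_cancel_left_pos)
  with eqs assms(1) have "s = 0" by simp
  with sr \<open>r = 0\<close> assms(3) show False by simp
qed

text \<open>If \<open>d\<close> and \<open>e\<close> were independent they would span
  \<open>p\<close>, so \<open>D p p = 0\<close>, against Euler's identity.\<close>

lemma kernel_D_parallel:
  assumes "p \<noteq> 0" "d \<noteq> 0" "D p d = 0" "D p e = 0"
  obtains c where "e = c *\<^sub>R d"
proof (cases "d $ 1 * e $ 2 = d $ 2 * e $ 1")
  case True
  then show ?thesis using parallel_if_det_eq_0 assms(2) that by metis
next
  case False
  obtain s r where sr: "p = s *\<^sub>R d + r *\<^sub>R e" using exhaust_basis[OF False] .
  note lin = linear_D[OF assms(1)]
  have "D p p = D p (s *\<^sub>R d + r *\<^sub>R e)" by (rule arg_cong[OF sr])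
  also have "\<dots> = 0" using assms(3,4) by (simp add: linear_add[OF lin] linear_scale[OF lin])
  finally have "D p p = 0" .
  then show ?thesis using D_self[OF assms(1)] assms(1) by simp
qed

section \<open>Flexes as linear conditions on derivatives\<close>

lemma smallo_increment_iff:
  assumes "p \<noteq> 0"
  shows "(\<lambda>t. N (p + t *\<^sub>R d) - N p) \<in> o[at_right 0](\<lambda>t. t) \<longleftrightarrow> D p d = 0"
proof -
  have "((\<lambda>t. (N (p + t *\<^sub>R d) - N p) / t) \<longlongrightarrow> D p d) (at 0)"
    using D_line[OF assms, of d] by (simp add: has_field_derivative_iff)
  then have lim: "((\<lambda>t. (N (p + t *\<^sub>R d) - N p) / t) \<longlongrightarrow> D p d) (at_right 0)"
    by (rule tendsto_within_subset) simp
  show ?thesis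
  proof
    assume "(\<lambda>t. N (p + t *\<^sub>R d) - N p) \<in> o[at_right 0](\<lambda>t. t)"
    then have "((\<lambda>t. (N (p + t *\<^sub>R d) - N p) / t) \<longlongrightarrow> 0) (at_right 0)"
      by (rule smalloD_tendsto)
    from tendsto_unique[OF trivial_limit_at_right_real lim this] show "D p d = 0" .
  next
    assume "D p d = 0"
    with lim have "((\<lambda>t. (N (p + t *\<^sub>R d) - N p) / t) \<longlongrightarrow> 0) (at_right 0)" by simp
    then show "(\<lambda>t. N (p + t *\<^sub>R d) - N p) \<in> o[at_right 0](\<lambda>t. t)"
      by (rule smalloI_tendsto) (simp add: eventually_at_filter)
  qed
qed

lemma infinitesimal_flex_iff:
  assumes "\<And>i j. {i, j} \<in> bars F \<Longrightarrow> placement F i \<noteq> placement F j"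
  shows "infinitesimal_flex N F u \<longleftrightarrow>
    (\<forall>i j. {i, j} \<in> bars F \<longrightarrow> D (placement F i - placement F j) (u i - u j) = 0)"
proof -
  have eq: "placement F i + t *\<^sub>R u i - (placement F j + t *\<^sub>R u j) =
    (placement F i - placement F j) + t *\<^sub>R (u i - u j)" for i j t
    by (simp add: algebra_simps)
  have "(\<lambda>t. N (placement F i - placement F j + t *\<^sub>R (u i - u j))
      - N (placement F i - placement F j)) \<in> o[at_right 0](\<lambda>t. t) \<longleftrightarrow>
    D (placement F i - placement F j) (u i - u j) = 0" if "{i, j} \<in> bars F" for i j
    using assms[OF that] by (intro smallo_increment_iff) simp
  then show ?thesis
    unfolding infinitesimal_flex_def eq by (intro iff_allI imp_cong refl)
qed

section \<open>Linear tangent fields and Euclidean norms\<close>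

lemma no_eigenvector:
  assumes inj: "\<And>v. L v = 0 \<Longrightarrow> v = 0"
    and tangent: "\<And>p. p \<noteq> 0 \<Longrightarrow> D p (L p) = 0"
    and "L v = c *\<^sub>R v"
  shows "v = 0"
proof (rule ccontr)
  assume v: "v \<noteq> 0"
  \<comment> \<open>Tangency combined with Euler's identity:
    \<open>D v (c *\<^sub>R v) = c * N v\<close>.\<close>
  then have "c * N v = 0"
    using tangent[OF v] assms(3) D_self[OF v] linear_scale[OF linear_D[OF v]] by simp
  then show False using inj[of v] assms(3) v by simp
qed

text \<open>Polar coordinates with respect to \<open>p\<close>, \<open>q\<close> and homogeneity
  determine \<open>N\<close> from its value \<open>K\<close> on the ellipse. The inner product is
  \<open>K\<^sup>2\<close> times the standard one in the coordinates \<open>s\<close>,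
  \<open>r\<close>.\<close>

lemma euclidean_norm_if_const_on_ellipse:
  assumes nonpar: "p $ 1 * q $ 2 \<noteq> p $ 2 * q $ 1"
    and const: "\<And>\<theta>. N (cos \<theta> *\<^sub>R p + sin \<theta> *\<^sub>R q) = K"
  shows "euclidean_norm N"
proof -
  have polar: "N (s *\<^sub>R p + r *\<^sub>R q) = sqrt (s\<^sup>2 + r\<^sup>2) * K" for s r
  proof (cases "s\<^sup>2 + r\<^sup>2 = 0")
    case True
    then show ?thesis by (simp add: sum_power2_eq_zero_iff)
  next
    case False
    define \<rho> where "\<rho> = sqrt (s\<^sup>2 + r\<^sup>2)"
    have \<rho>: "0 < \<rho>" "\<rho>\<^sup>2 = s\<^sup>2 + r\<^sup>2"
      using False by (auto simp: \<rho>_def sum_power2_gt_zero_iff sum_power2_eq_zero_iff)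
    have "(s / \<rho>)\<^sup>2 + (r / \<rho>)\<^sup>2 = (s\<^sup>2 + r\<^sup>2) / \<rho>\<^sup>2"
      by (simp add: power_divide add_divide_distrib)
    also have "\<dots> = 1" unfolding \<rho>(2) using False by (rule divide_self)
    finally obtain \<theta> where \<theta>: "s / \<rho> = cos \<theta>" "r / \<rho> = sin \<theta>"
      using sincos_total_2pi by metis
    then have "s = \<rho> * cos \<theta>" "r = \<rho> * sin \<theta>" using \<rho>(1) by (simp_all add: field_simps)
    then have "s *\<^sub>R p + r *\<^sub>R q = \<rho> *\<^sub>R (cos \<theta> *\<^sub>R p + sin \<theta> *\<^sub>R q)" by (simp add: scaleR_add_right)
    then show ?thesis using \<rho>(1) by (simp add: N_scale const \<rho>_def)
  qed
  define d where "d = p $ 1 * q $ 2 - p $ 2 * q $ 1"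
  have d: "d \<noteq> 0" using nonpar unfolding d_def by linarith
  define s r where "s v = (v $ 1 * q $ 2 - v $ 2 * q $ 1) / d"
    and "r v = (p $ 1 * v $ 2 - p $ 2 * v $ 1) / d" for v :: "real^2"
  have coords: "v = s v *\<^sub>R p + r v *\<^sub>R q" for v
  proof -
    obtain s' r' where v: "v = s' *\<^sub>R p + r' *\<^sub>R q" using exhaust_basis[OF nonpar] .
    have "v $ 1 * q $ 2 - v $ 2 * q $ 1 = s' * d" "p $ 1 * v $ 2 - p $ 2 * v $ 1 = r' * d"
      unfolding v d_def by (simp_all add: algebra_simps)
    with d have "s v = s'" "r v = r'" by (simp_all add: s_def r_def)
    with v show ?thesis by simp
  qed
  have lin: "s (v + w) = s v + s w" "r (v + w) = r v + r w" "s (c *\<^sub>R v) = c * s v" "r (c *\<^sub>R v) = c * r v"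
    for v w c
    by (simp_all add: s_def r_def algebra_simps add_divide_distrib diff_divide_distrib)
  define b where "b v w = K\<^sup>2 * (s v * s w + r v * r w)" for v w
  have Nb: "N v = sqrt (b v v)" for v
  proof -
    have "0 \<le> K" using const[of 0] N_nonneg by metis
    then have "sqrt (b v v) = sqrt ((s v)\<^sup>2 + (r v)\<^sup>2) * K"
      by (simp add: b_def real_sqrt_mult power2_eq_square)
    then show ?thesis using polar[of "s v" "r v"] coords[of v] by simp
  qed
  have "bilinear b"
    unfolding bilinear_def linear_iff b_def by (simp add: lin algebra_simps)
  moreover have "b v w = b w v" for v w by (simp add: b_def mult.commute)
  moreover have "0 < b v v" if "v \<noteq> 0" for v using N_pos[OF that] Nb[of v] by simp
  ultimately have "inner_product_on_plane b" by (auto simp: inner_product_on_plane_def)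
  with Nb show ?thesis unfolding euclidean_norm_def by blast
qed

text \<open>In a suitable basis \<open>L\<close> is a multiple of the identity plus a multiple of a
  quarter turn, and its flow lines are spirals along which \<open>N\<close> is constant. One full
  turn excludes any growth of the radius, so the spiral is an ellipse.\<close>

lemma euclidean_norm_if_linear_tangent_field:
  assumes L: "linear L"
    and inj: "\<And>v. L v = 0 \<Longrightarrow> v = 0"
    and tangent: "\<And>p. p \<noteq> 0 \<Longrightarrow> D p (L p) = 0"
  shows "euclidean_norm N"
proof -
  have eigen: "v = 0" if "L v = c *\<^sub>R v" for v c
    using no_eigenvector[of L v c] inj tangent that by blast
  define p :: "real^2" where "p = vector [1, 0]"
  have p: "p \<noteq> 0" by (auto simp: p_def vec_eq_iff forall_2)
  define w where "w = L p"
  have pw: "p $ 1 * w $ 2 \<noteq> p $ 2 * w $ 1"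
  proof
    assume "p $ 1 * w $ 2 = p $ 2 * w $ 1"
    then obtain c where "w = c *\<^sub>R p" using parallel_if_det_eq_0 p by blast
    with eigen[of p c] p show False by (simp add: w_def)
  qed
  obtain s t where Lw: "L w = s *\<^sub>R p + t *\<^sub>R w" using exhaust_basis[OF pw] .
  have Llin: "L (v + v') = L v + L v'" "L (c *\<^sub>R v) = c *\<^sub>R L v" "L (v - v') = L v - L v'" for v v' c
    using L by (simp_all add: linear_add linear_scale linear_diff)
  have disc: "t\<^sup>2 / 4 + s < 0"
  proof (rule ccontr)
    assume nn: "\<not> t\<^sup>2 / 4 + s < 0"
    \<comment> \<open>A real root of the characteristic equation
      \<open>\<mu>\<^sup>2 = t * \<mu> + s\<close>; the vector \<open>v\<close> below is an
      eigenvector for it.\<close>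
    define \<mu> where "\<mu> = t / 2 + sqrt (t\<^sup>2 / 4 + s)"
    have "(\<mu> - t / 2)\<^sup>2 = t\<^sup>2 / 4 + s" using nn by (simp add: \<mu>_def)
    then have \<mu>: "\<mu> * (\<mu> - t) = s" by (simp add: power2_eq_square algebra_simps)
    define v where "v = w + (\<mu> - t) *\<^sub>R p"
    have "L v = s *\<^sub>R p + \<mu> *\<^sub>R w" by (simp add: v_def Llin Lw algebra_simps flip: w_def)
    also have "\<dots> = \<mu> *\<^sub>R v" by (simp add: v_def scaleR_add_right \<mu>)
    finally have "v = 0" by (rule eigen)
    then have "w = (t - \<mu>) *\<^sub>R p" by (simp add: v_def algebra_simps eq_neg_iff_add_eq_0)
    with pw show False by simp
  qed
  \<comment> \<open>Real and imaginary part of a complex eigenvalue of \<open>L\<close>. The vector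
    \<open>q\<close> is chosen so that
    \<open>L p = \<alpha> *\<^sub>R p + \<omega> *\<^sub>R q\<close> and
    \<open>L q = \<alpha> *\<^sub>R q - \<omega> *\<^sub>R p\<close>.\<close>
  define \<alpha> \<omega> where "\<alpha> = t / 2" and "\<omega> = sqrt (- (t\<^sup>2 / 4 + s))"
  have \<omega>: "0 < \<omega>" "\<omega>\<^sup>2 = - (\<alpha>\<^sup>2) - s" using disc by (auto simp: \<omega>_def \<alpha>_def power_divide)
  define q where "q = (1 / \<omega>) *\<^sub>R (w - \<alpha> *\<^sub>R p)"
  have w: "w = \<alpha> *\<^sub>R p + \<omega> *\<^sub>R q" using \<omega>(1) by (simp add: q_def)
  have Lp: "L p = \<alpha> *\<^sub>R p + \<omega> *\<^sub>R q" using w by (simp add: w_def)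
  have "L q = (1 / \<omega>) *\<^sub>R (s *\<^sub>R p + t *\<^sub>R w - \<alpha> *\<^sub>R w)"
    by (simp add: q_def Llin Lw flip: w_def)
  also have "s *\<^sub>R p + t *\<^sub>R w - \<alpha> *\<^sub>R w = s *\<^sub>R p + (t - \<alpha>) *\<^sub>R w"
    by (simp add: scaleR_left_diff_distrib)
  also have "\<dots> = (s + \<alpha>\<^sup>2) *\<^sub>R p + (\<alpha> * \<omega>) *\<^sub>R q"
    by (subst w) (simp add: \<alpha>_def scaleR_add_right scaleR_add_left power2_eq_square)
  also have "s + \<alpha>\<^sup>2 = - (\<omega> * \<omega>)" using \<omega>(2) by (simp add: power2_eq_square)
  also have "(1 / \<omega>) *\<^sub>R (- (\<omega> * \<omega>) *\<^sub>R p + (\<alpha> * \<omega>) *\<^sub>R q) = \<alpha> *\<^sub>R q - \<omega> *\<^sub>R p"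
    using \<omega>(1) by (simp add: scaleR_add_right scaleR_diff_right)
  finally have Lq: "L q = \<alpha> *\<^sub>R q - \<omega> *\<^sub>R p" .
  have pq: "p $ 1 * q $ 2 \<noteq> p $ 2 * q $ 1"
    using pw \<omega>(1) by (simp add: q_def p_def)
  define h where "h \<theta> = cos \<theta> *\<^sub>R p + sin \<theta> *\<^sub>R q" for \<theta>
  \<comment> \<open>The flow line of \<open>L\<close> through \<open>p\<close>, with time multiplied
    by \<omega> so that the parameter is the angle.\<close>
  define g where "g \<theta> = exp (\<alpha> / \<omega> * \<theta>) *\<^sub>R h \<theta>" for \<theta>
  have "h \<theta> \<noteq> 0" for \<theta>
  proof
    assume h: "h \<theta> = 0"
    then have "h \<theta> $ i = 0" for i by simp
    then have "cos \<theta> * p $ i + sin \<theta> * q $ i = 0" for i by (simp add: h_def)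
    from this[of 1] this[of 2] have "cos \<theta> * (p $ 1 * q $ 2 - p $ 2 * q $ 1) = 0"
      "sin \<theta> * (p $ 1 * q $ 2 - p $ 2 * q $ 1) = 0" by algebra+
    with pq have "cos \<theta> = 0" "sin \<theta> = 0" by auto
    then show False using sin_cos_squared_add[of \<theta>] by simp
  qed
  then have g0: "g \<theta> \<noteq> 0" for \<theta> by (simp add: g_def)
  define k where "k \<theta> = cos \<theta> *\<^sub>R q - sin \<theta> *\<^sub>R p" for \<theta>
  define g' where "g' \<theta> = exp (\<alpha> / \<omega> * \<theta>) *\<^sub>R k \<theta> + (exp (\<alpha> / \<omega> * \<theta>) * (\<alpha> / \<omega>)) *\<^sub>R h \<theta>" for \<theta>
  have "(h has_vector_derivative (cos \<theta> *\<^sub>R 0 + (- sin \<theta>) *\<^sub>R p + (sin \<theta> *\<^sub>R 0 + cos \<theta> *\<^sub>R q))) (at \<theta>)" for \<theta>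
    unfolding h_def[abs_def]
    by (intro has_vector_derivative_add has_vector_derivative_scaleR has_vector_derivative_const
        DERIV_cos DERIV_sin)
  then have h': "(h has_vector_derivative k \<theta>) (at \<theta>)" for \<theta> by (simp add: k_def)
  have "((\<lambda>\<theta>. exp (\<alpha> / \<omega> * \<theta>)) has_field_derivative exp (\<alpha> / \<omega> * \<theta>) * (\<alpha> / \<omega>)) (at \<theta>)" for \<theta>
    using \<omega>(1) by (auto intro!: derivative_eq_intros)
  then have g': "(g has_vector_derivative g' \<theta>) (at \<theta>)" for \<theta>
    unfolding g_def[abs_def] g'_def by (intro has_vector_derivative_scaleR h')
  have "L (g \<theta>) = \<omega> *\<^sub>R g' \<theta>" for \<theta>
  proof -
    have "L (h \<theta>) = \<alpha> *\<^sub>R h \<theta> + \<omega> *\<^sub>R k \<theta>"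
      by (simp add: h_def k_def Llin Lp Lq algebra_simps)
    then show ?thesis using \<omega>(1) by (simp add: g_def g'_def Llin scaleR_add_right add.commute mult.commute)
  qed
  then have D0: "D (g \<theta>) (g' \<theta>) = 0" for \<theta>
    using tangent[OF g0, of \<theta>] \<omega>(1) linear_scale[OF linear_D[OF g0]] by simp
  have "((\<lambda>\<theta>. N (g \<theta>)) has_real_derivative 0) (at \<theta>)" for \<theta>
    using vector_derivative_diff_chain_within[OF g', of N "D (g \<theta>)" \<theta>] D0[of \<theta>]
      has_derivative_at_withinI[OF has_derivative_N[OF g0]]
    by (simp add: o_def has_real_derivative_iff_has_vector_derivative)
  then have const: "N (g \<theta>) = N (g \<theta>')" for \<theta> \<theta>' by (intro DERIV_isconst_all) blast
  have h2pi: "h (2 * pi) = p" "h 0 = p" by (simp_all add: h_def)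
  \<comment> \<open>After one turn the spiral returns to the ray through \<open>p\<close>.\<close>
  have "exp (\<alpha> / \<omega> * (2 * pi)) * N p = N p"
    using const[of "2 * pi" 0] by (simp add: g_def h2pi N_scale)
  then have "\<alpha> = 0" using p \<omega>(1) by simp
  then have "N (h \<theta>) = N (h 0)" for \<theta> using const[of \<theta> 0] by (simp add: g_def)
  then show ?thesis using euclidean_norm_if_const_on_ellipse[OF pq, of "N (h 0)"] by (simp add: h_def)
qed

section \<open>Tangential directions and brace parameters\<close>

lemma tangential_iff:
  assumes "q \<noteq> 0"
  shows "tangential N q d \<longleftrightarrow> d \<noteq> 0 \<and> D q d = 0"
  using D_scale[OF assms, of "inverse (N q)"] N_pos[OF assms] by (simp add: tangential_def)

text \<open>The kernel of \<open>D q\<close> is a line that does not contain \<open>q\<close>. As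
  \<open>q\<close> lies on a coordinate axis, that line is transverse to the axis, so length and
  sign of the \<open>i\<close>-th coordinate single out one vector.\<close>

lemma ex1_tangential:
  assumes q: "q \<noteq> 0" "q $ i = 0"
  shows "\<exists>!u. N u = 1 \<and> 0 < u $ i \<and> tangential N q u"
proof -
  obtain d where d: "d \<noteq> 0" "D q d = 0" using exists_linear_kernel_vector[OF linear_D[OF q(1)]] .
  have di: "d $ i \<noteq> 0"
  proof
    assume "d $ i = 0"
    then have "q $ 1 * d $ 2 = q $ 2 * d $ 1" using q(2) exhaust_2[of i] by auto
    then obtain c where "d = c *\<^sub>R q" using parallel_if_det_eq_0 q(1) by blast
    then show False using d D_self[OF q(1)] linear_scale[OF linear_D[OF q(1)]] q(1) by auto
  qed
  define u where "u = (sgn (d $ i) / N d) *\<^sub>R d"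
  have u: "N u = 1" "0 < u $ i" "D q u = 0"
    using d di N_pos[OF d(1)] linear_scale[OF linear_D[OF q(1)]]
    by (auto simp: u_def N_scale abs_sgn_eq sgn_if)
  then have u0: "u \<noteq> 0" by auto
  show ?thesis
  proof (rule ex1I[of _ u])
    show "N u = 1 \<and> 0 < u $ i \<and> tangential N q u" using u u0 q(1) by (simp add: tangential_iff)
    fix v assume v: "N v = 1 \<and> 0 < v $ i \<and> tangential N q v"
    then obtain c where c: "v = c *\<^sub>R u"
      using kernel_D_parallel[OF q(1) u0 u(3)] q(1) by (auto simp: tangential_iff)
    with v u have "\<bar>c\<bar> = 1" "0 < c" by (auto simp: N_scale zero_less_mult_iff)
    with c show "v = u" by simp
  qed
qed

text \<open>On the line through \<open>s *\<^sub>R e\<close> in direction \<open>u\<close>, the norm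
  is smallest at \<open>s *\<^sub>R e\<close>, so by convexity it does not decrease from
  \<open>q\<close> onwards. Its derivative there is not 0, since \<open>e\<close> and
  \<open>q\<close> would then share a tangent.\<close>

lemma D_pos_beyond_tangent:
  assumes e: "e \<noteq> 0" and u: "u \<noteq> 0" "D e u = 0" and q: "q = s *\<^sub>R e + r *\<^sub>R u" "0 < r"
  shows "0 < D q u"
proof -
  note lin = linear_D[OF e]
  have nonpar: "e $ 1 * u $ 2 \<noteq> e $ 2 * u $ 1"
  proof
    assume "e $ 1 * u $ 2 = e $ 2 * u $ 1"
    then obtain c where "u = c *\<^sub>R e" using parallel_if_det_eq_0 e by blast
    then show False using u e D_self[OF e] linear_scale[OF lin] by auto
  qed
  have "e $ 1 * q $ 2 - e $ 2 * q $ 1 = r * (e $ 1 * u $ 2 - e $ 2 * u $ 1)"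
    by (simp add: q algebra_simps)
  with nonpar q(2) have eq: "e $ 1 * q $ 2 \<noteq> e $ 2 * q $ 1" by auto
  then have q0: "q \<noteq> 0" by auto
  note linq = linear_D[OF q0]
  have "D e q = s * N e"
    using u(2) D_self[OF e] by (simp add: q linear_add[OF lin] linear_scale[OF lin])
  then have "\<bar>s\<bar> * N e \<le> N q" using abs_D_le[OF e, of q] by (simp add: abs_mult)
  moreover have "D q (s *\<^sub>R e) \<le> \<bar>s\<bar> * N e" using D_le[OF q0, of "s *\<^sub>R e"] by (simp add: N_scale)
  moreover have "D q q = D q (s *\<^sub>R e) + r * D q u"
    by (subst (2) q) (simp add: linear_add[OF linq] linear_scale[OF linq])
  ultimately have "0 \<le> r * D q u" using D_self[OF q0] by linarith
  then have "0 \<le> D q u" using q(2) by (simp add: zero_le_mult_iff)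
  moreover have "D q u \<noteq> 0" using parallel_if_common_tangent[OF e q0 u] eq by blast
  ultimately show ?thesis by simp
qed

abbreviation e1 :: "real^2" where "e1 \<equiv> vector [1, 0]"
abbreviation e2 :: "real^2" where "e2 \<equiv> vector [0, 1]"
abbreviation ux :: "real^2" where "ux \<equiv> tangent_x N"
abbreviation uy :: "real^2" where "uy \<equiv> tangent_y N"

lemma e1_neq_0: "e1 \<noteq> 0" and e2_neq_0: "e2 \<noteq> 0"
  by (auto simp: vec_eq_iff forall_2)

lemma tangent_x: "ux \<noteq> 0" "0 < ux $ 1" "D e2 ux = 0"
proof -
  have "N ux = 1 \<and> 0 < ux $ 1 \<and> tangential N e2 ux"
    unfolding tangent_x_def by (rule theI', rule ex1_tangential) (simp_all add: e2_neq_0)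
  then show "ux \<noteq> 0" "0 < ux $ 1" "D e2 ux = 0" by (simp_all add: tangential_iff e2_neq_0)
qed

lemma tangent_y: "uy \<noteq> 0" "0 < uy $ 2" "D e1 uy = 0"
proof -
  have "N uy = 1 \<and> 0 < uy $ 2 \<and> tangential N e1 uy"
    unfolding tangent_y_def by (rule theI', rule ex1_tangential) (simp_all add: e1_neq_0)
  then show "uy \<noteq> 0" "0 < uy $ 2" "D e1 uy = 0" by (simp_all add: tangential_iff e1_neq_0)
qed

lemma tangents_not_parallel: "ux $ 1 * uy $ 2 \<noteq> ux $ 2 * uy $ 1"
proof
  assume "ux $ 1 * uy $ 2 = ux $ 2 * uy $ 1"
  then obtain c where "uy = c *\<^sub>R ux" using parallel_if_det_eq_0 tangent_x(1) by blast
  then have "D e2 uy = 0" using tangent_x(3) linear_scale[OF linear_D[OF e2_neq_0]] by simp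
  from parallel_if_common_tangent[OF e1_neq_0 e2_neq_0 tangent_y(1,3) this] show False by simp
qed

lemma D_tangent_x_pos:
  assumes "0 < q $ 1"
  shows "0 < D q ux"
proof (rule D_pos_beyond_tangent[OF e2_neq_0 tangent_x(1,3)])
  show "q = (q $ 2 - q $ 1 / ux $ 1 * ux $ 2) *\<^sub>R e2 + (q $ 1 / ux $ 1) *\<^sub>R ux"
    using tangent_x(2) by (simp add: vec_eq_iff forall_2)
  show "0 < q $ 1 / ux $ 1" using assms tangent_x(2) by simp
qed

lemma D_tangent_y_pos:
  assumes "0 < q $ 2"
  shows "0 < D q uy"
proof (rule D_pos_beyond_tangent[OF e1_neq_0 tangent_y(1,3)])
  show "q = (q $ 1 - q $ 2 / uy $ 2 * uy $ 1) *\<^sub>R e1 + (q $ 2 / uy $ 2) *\<^sub>R uy"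
    using tangent_y(2) by (simp add: vec_eq_iff forall_2)
  show "0 < q $ 2 / uy $ 2" using assms tangent_y(2) by simp
qed

text \<open>The condition is linear in \<open>a\<close> and \<open>b\<close>. Its coefficients
  \<open>D q ux\<close> and \<open>colour_sign * D q uy\<close> have opposite signs, so its
  solutions are \<open>b = l * a\<close> for a positive ratio \<open>l\<close>. With
  \<open>a\<close> and \<open>b\<close> the values at the column and the row of a cell, this is the
  potential equation.\<close>

lemma brace_parameter:
  assumes xy: "x j < x (j + 1)" "y k < y (k + 1)"
  shows brace_parameter_pos: "0 < brace_parameter N x y (j, k, c)" (is "0 < ?l")
    and D_brace_vector_eq_0_iff: "D (brace_vector x y (j, k, c)) (a *\<^sub>R uy + (colour_sign (j, k, c) * b) *\<^sub>R ux) = 0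
      \<longleftrightarrow> b = brace_parameter N x y (j, k, c) * a"
proof -
  define e where "e = (j, k, c)"
  let ?q = "brace_vector x y e" and ?s = "colour_sign e"
  have q1: "0 < ?q $ 1" using xy by (cases c) (simp_all add: e_def)
  then have q0: "?q \<noteq> 0" by auto
  note lin = linear_add[OF linear_D[OF q0]] linear_scale[OF linear_D[OF q0]]
  have dx: "0 < D ?q ux" by (rule D_tangent_x_pos[OF q1])
  \<comment> \<open>A blue brace vector points downwards, so positivity is applied to its
    negative.\<close>
  have dy: "?s * D ?q uy < 0"
  proof (cases c)
    case Blue
    have "- ?q \<noteq> 0" using q0 by simp
    moreover have "0 < D (- ?q) uy" by (rule D_tangent_y_pos) (use xy Blue in \<open>simp add: e_def\<close>)
    ultimately show ?thesis using D_minus_left[OF q0, of uy] Blue by (simp add: e_def)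
  next
    case Red
    have "0 < D ?q uy" by (rule D_tangent_y_pos) (use xy Red in \<open>simp add: e_def\<close>)
    then show ?thesis using Red by (simp add: e_def)
  qed
  have s2: "?s * ?s = 1" by (cases c) (simp_all add: e_def)
  define l where "l = - (?s * D ?q uy) / D ?q ux"
  have iff: "D ?q (a *\<^sub>R uy + (?s * b) *\<^sub>R ux) = 0 \<longleftrightarrow> b = l * a" for a b
  proof -
    have "?s * D ?q (a *\<^sub>R uy + (?s * b) *\<^sub>R ux) = a * (?s * D ?q uy) + (?s * ?s) * b * D ?q ux"
      by (simp only: lin real_scaleR_def) (simp add: algebra_simps)
    also have "\<dots> = (b - l * a) * D ?q ux" using dx s2 by (simp add: l_def field_simps)
    finally have "?s * D ?q (a *\<^sub>R uy + (?s * b) *\<^sub>R ux) = (b - l * a) * D ?q ux" .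
    moreover have "?s \<noteq> 0" using s2 by auto
    ultimately show ?thesis using dx by (metis eq_iff_diff_eq_0 less_irrefl mult_eq_0_iff)
  qed
  have nz: "(?s * b) *\<^sub>R ux + uy \<noteq> 0" for b
  proof
    assume 0: "(?s * b) *\<^sub>R ux + uy = 0"
    have "uy $ i = - (?s * b) * ux $ i" for i
      using arg_cong[OF 0, of "\<lambda>v. v $ i"] by simp
    with tangents_not_parallel show False by simp
  qed
  have tan: "tangential N ?q ((?s * b) *\<^sub>R ux + uy) \<longleftrightarrow> b = l" for b
    using iff[of 1 b] nz[of b] by (simp add: tangential_iff[OF q0] add.commute)
  have l: "0 < l" using dx dy by (simp add: l_def divide_neg_pos)
  have "brace_parameter N x y e = l"
    unfolding brace_parameter_def tan using l by (intro the_equality) auto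
  with l iff show "0 < brace_parameter N x y (j, k, c)"
    "D (brace_vector x y (j, k, c)) (a *\<^sub>R uy + (colour_sign (j, k, c) * b) *\<^sub>R ux) = 0
      \<longleftrightarrow> b = brace_parameter N x y (j, k, c) * a"
    by (auto simp: e_def)
qed

section \<open>Continuity, parallelograms and lattices\<close>

lemma D_minus_minus: "p \<noteq> 0 \<Longrightarrow> D (- p) (- d) = D p d"
  using D_minus_left[of p "- d"] linear_neg[OF linear_D[of p], of d] by simp

lemma D_doubleton_iff:
  assumes "P a \<noteq> P b"
  shows "(\<forall>i j. {i, j} = {a, b} \<longrightarrow> D (P i - P j) (u i - u j) = 0) \<longleftrightarrow> D (P b - P a) (u b - u a) = 0"
proof
  assume "\<forall>i j. {i, j} = {a, b} \<longrightarrow> D (P i - P j) (u i - u j) = 0"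
  then show "D (P b - P a) (u b - u a) = 0" by (simp add: insert_commute)
next
  assume ba: "D (P b - P a) (u b - u a) = 0"
  then have ab: "D (P a - P b) (u a - u b) = 0"
    using D_minus_minus[of "P b - P a" "u b - u a"] assms by simp
  show "\<forall>i j. {i, j} = {a, b} \<longrightarrow> D (P i - P j) (u i - u j) = 0"
    unfolding doubleton_eq_iff using ab ba by blast
qed

lemma convex_on_N: "convex_on UNIV N"
proof (rule convex_onI)
  fix t :: real and v w
  assume "0 < t" "t < 1"
  then show "N ((1 - t) *\<^sub>R v + t *\<^sub>R w) \<le> (1 - t) * N v + t * N w"
    using N_triangle[of "(1 - t) *\<^sub>R v" "t *\<^sub>R w"] by (simp add: N_scale)
qed simp

lemma isCont_N: "isCont N v"
  using convex_on_continuous[OF open_UNIV convex_on_N] by (simp add: continuous_on_eq_continuous_at)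

text \<open>Closing up around the four joints shows that the two opposite sides in direction
  \<open>d\<close> and those in direction \<open>e\<close> have the same defect. It lies in the
  kernels of both \<open>D d\<close> and \<open>D e\<close>, so it is 0.\<close>

lemma parallelogram:
  assumes P: "P i1 - P i0 = d" "P i3 - P i2 = d" "P i2 - P i0 = e" "P i3 - P i1 = e"
    and nonpar: "d $ 1 * e $ 2 \<noteq> d $ 2 * e $ 1"
    and u: "\<And>i j. P i \<noteq> P j \<Longrightarrow> D (P i - P j) (u i - u j) = 0"
  shows "u i1 - u i0 = u i3 - u i2"
proof (rule ccontr)
  assume "u i1 - u i0 \<noteq> u i3 - u i2"
  then have ne: "(u i1 - u i0) - (u i3 - u i2) \<noteq> 0" by simp
  have d0: "d \<noteq> 0" and e0: "e \<noteq> 0" using nonpar by auto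
  have du: "D (P i - P j) (u i - u j) = 0" if "P i - P j \<noteq> 0" for i j
    using u[of i j] that by simp
  have "D d (u i1 - u i0) = 0" "D d (u i3 - u i2) = 0" "D e (u i2 - u i0) = 0" "D e (u i3 - u i1) = 0"
    using du[of i1 i0] du[of i3 i2] du[of i2 i0] du[of i3 i1] d0 e0 unfolding P by simp_all
  then have "D d ((u i1 - u i0) - (u i3 - u i2)) = 0" "D e ((u i2 - u i0) - (u i3 - u i1)) = 0"
    by (simp_all only: linear_diff[OF linear_D[OF d0]] linear_diff[OF linear_D[OF e0]] diff_self)
  moreover have "(u i2 - u i0) - (u i3 - u i1) = (u i1 - u i0) - (u i3 - u i2)" by simp
  ultimately have "D d ((u i1 - u i0) - (u i3 - u i2)) = 0" "D e ((u i1 - u i0) - (u i3 - u i2)) = 0"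
    by simp_all
  from parallel_if_common_tangent[OF d0 e0 ne this] nonpar show False by simp
qed

text \<open>Approximates both coordinates of a point with one common denominator, hence the point by
  lattice vectors divided by \<open>Suc n\<close>.\<close>

lemma floor_quotient_tendsto: "(\<lambda>n. real_of_int \<lfloor>real (Suc n) * s\<rfloor> / real (Suc n)) \<longlonglongrightarrow> s"
proof (rule tendsto_sandwich)
  have "s - inverse (real (Suc n)) \<le> real_of_int \<lfloor>real (Suc n) * s\<rfloor> / real (Suc n)" for n
  proof -
    have "real (Suc n) * s - 1 \<le> real_of_int \<lfloor>real (Suc n) * s\<rfloor>" by linarith
    then have "(real (Suc n) * s - 1) / real (Suc n) \<le> real_of_int \<lfloor>real (Suc n) * s\<rfloor> / real (Suc n)"
      by (rule divide_right_mono) simp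
    then show ?thesis by (simp add: diff_divide_distrib inverse_eq_divide del: of_nat_Suc)
  qed
  then show "\<forall>\<^sub>F n in sequentially. s - inverse (real (Suc n)) \<le> real_of_int \<lfloor>real (Suc n) * s\<rfloor> / real (Suc n)"
    by simp
  have "real_of_int \<lfloor>real (Suc n) * s\<rfloor> / real (Suc n) \<le> s" for n
  proof -
    have "real_of_int \<lfloor>real (Suc n) * s\<rfloor> \<le> s * real (Suc n)" by (simp add: mult.commute del: of_nat_Suc)
    then show ?thesis by (simp add: pos_divide_le_eq del: of_nat_Suc)
  qed
  then show "\<forall>\<^sub>F n in sequentially. real_of_int \<lfloor>real (Suc n) * s\<rfloor> / real (Suc n) \<le> s" by simp
  show "(\<lambda>n. s - inverse (real (Suc n))) \<longlonglongrightarrow> s"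
    using tendsto_diff[OF tendsto_const LIMSEQ_inverse_real_of_nat, of s] by simp
qed simp

text \<open>Tangency at \<open>v\<close> means that \<open>N v \<le> N (v + t *\<^sub>R L v)\<close>
  for all \<open>t\<close>. This form passes to rational multiples of lattice vectors by homogeneity
  and to all points by continuity of \<open>N\<close>. At \<open>p\<close>, the minimum at
  \<open>t = 0\<close> gives back the vanishing derivative.\<close>

lemma linear_tangent_field_if_on_lattice:
  assumes hl: "0 < h" "0 < l" and L: "linear L"
    and lattice: "\<And>a b. a \<noteq> 0 \<or> b \<noteq> 0 \<Longrightarrow>
      D (vector [real_of_int a * h, real_of_int b * l]) (L (vector [real_of_int a * h, real_of_int b * l])) = 0"
    and p: "p \<noteq> 0"
  shows "D p (L p) = 0"
proof -
  have ge: "N p \<le> N (p + t *\<^sub>R L p)" for t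
  proof -
    have int: "N v \<le> N (v + t *\<^sub>R L v)" if "v = vector [real_of_int a * h, real_of_int b * l]" for a b v
    proof (cases "a = 0 \<and> b = 0")
      case True
      then have "v = 0" using that by (auto simp: vec_eq_iff forall_2)
      then show ?thesis by (simp add: linear_0[OF L])
    next
      case False
      then have v: "v \<noteq> 0" using that hl by (auto simp: vec_eq_iff forall_2)
      have "D v (v + t *\<^sub>R L v) = N v"
        using lattice[of a b] False D_self[OF v] linear_add[OF linear_D[OF v]] linear_scale[OF linear_D[OF v]] that
        by simp
      then show ?thesis using D_le[OF v, of "v + t *\<^sub>R L v"] by simp
    qed
    define v :: "nat \<Rightarrow> real^2" where "v n = vector
      [real_of_int \<lfloor>real (Suc n) * (p $ 1 / h)\<rfloor> / real (Suc n) * h,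
       real_of_int \<lfloor>real (Suc n) * (p $ 2 / l)\<rfloor> / real (Suc n) * l]" for n
    have le: "N (v n) \<le> N (v n + t *\<^sub>R L (v n))" for n
    proof -
      have "real (Suc n) *\<^sub>R v n = vector [real_of_int \<lfloor>real (Suc n) * (p $ 1 / h)\<rfloor> * h,
          real_of_int \<lfloor>real (Suc n) * (p $ 2 / l)\<rfloor> * l]"
        by (simp add: v_def vec_eq_iff forall_2 del: of_nat_Suc)
      from int[OF this] have "N (real (Suc n) *\<^sub>R v n) \<le> N (real (Suc n) *\<^sub>R (v n + t *\<^sub>R L (v n)))"
        by (simp add: linear_scale[OF L] scaleR_add_right mult.commute del: of_nat_Suc)
      then show ?thesis by (simp add: N_scale del: of_nat_Suc)
    qed
    have "(\<lambda>n. v n $ i) \<longlonglongrightarrow> p $ i" for i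
    proof -
      have "i = 1 \<or> i = 2" by (rule exhaust_2)
      then show ?thesis
        using tendsto_mult[OF floor_quotient_tendsto[of "p $ 1 / h"] tendsto_const[of h]]
          tendsto_mult[OF floor_quotient_tendsto[of "p $ 2 / l"] tendsto_const[of l]] hl
        by (auto simp: v_def simp del: of_nat_Suc)
    qed
    then have lim: "v \<longlonglongrightarrow> p" by (rule vec_tendstoI)
    have "(\<lambda>n. L (v n)) \<longlonglongrightarrow> L p"
      using linear_continuous_at[of L p] L lim by (auto simp: linear_conv_bounded_linear intro: isCont_tendsto_compose)
    with lim have "(\<lambda>n. v n + t *\<^sub>R L (v n)) \<longlonglongrightarrow> p + t *\<^sub>R L p" by (intro tendsto_intros)
    then have "(\<lambda>n. N (v n + t *\<^sub>R L (v n))) \<longlonglongrightarrow> N (p + t *\<^sub>R L p)"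
      by (rule isCont_tendsto_compose[OF isCont_N])
    moreover have "(\<lambda>n. N (v n)) \<longlonglongrightarrow> N p" by (rule isCont_tendsto_compose[OF isCont_N lim])
    ultimately show ?thesis using le by (meson LIMSEQ_le)
  qed
  show ?thesis
    by (rule DERIV_local_min[OF D_line[OF p], of 1]) (use ge in simp_all)
qed

end

section \<open>Flexes of braced grids\<close>

text \<open>Oriented from the left to the right end, in agreement with \<open>brace_vector\<close>;
  the set \<open>brace_bar\<close> has no orientation.\<close>

fun brace_diff :: "(nat \<times> nat \<Rightarrow> real^2) \<Rightarrow> brace \<Rightarrow> real^2" where
  "brace_diff u (j, k, Blue) = u (j + 1, k) - u (j, k + 1)"
| "brace_diff u (j, k, Red) = u (j + 1, k + 1) - u (j, k)"

locale grid = plane_norm +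
  fixes m n :: nat and x y :: "nat \<Rightarrow> real"
  assumes m: "1 \<le> m" and n: "1 \<le> n"
    and x: "strict_mono_on {0..m} x" and y: "strict_mono_on {0..n} y"
begin

abbreviation F :: "brace set \<Rightarrow> (nat \<times> nat) framework" where
  "F B \<equiv> braced_grid m n x y B"

abbreviation l :: "brace \<Rightarrow> real" where
  "l \<equiv> brace_parameter N x y"

section \<open>Placement and bars of the braced grid\<close>

lemma x_less: "j < m \<Longrightarrow> x j < x (j + 1)" and y_less: "k < n \<Longrightarrow> y k < y (k + 1)"
  using strict_mono_onD[OF x, of j "j + 1"] strict_mono_onD[OF y, of k "k + 1"] by auto

lemma joints_F: "joints (F B) = {0..m} \<times> {0..n}"
  and placement_F: "placement (F B) (j, k) = vector [x j, y k]"
  and bars_F: "bars (F B) = grid_bars m n \<union> brace_bar ` B"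
  by (simp_all add: braced_grid_def)

lemma inj_on_placement_F: "inj_on (placement (F B)) ({0..m} \<times> {0..n})"
proof (rule inj_onI)
  fix p q
  assume pq: "p \<in> {0..m} \<times> {0..n}" "q \<in> {0..m} \<times> {0..n}" "placement (F B) p = placement (F B) q"
  obtain j k j' k' where [simp]: "p = (j, k)" "q = (j', k')" by (metis surj_pair)
  have "x j = x j'" "y k = y k'"
    using arg_cong[OF pq(3), of "\<lambda>v. v $ 1"] arg_cong[OF pq(3), of "\<lambda>v. v $ 2"]
    by (simp_all add: placement_F)
  then show "p = q"
    using pq(1,2) strict_mono_on_imp_inj_on[OF x] strict_mono_on_imp_inj_on[OF y]
    by (auto dest: inj_onD)
qed

lemma bar_is_doubleton:
  assumes "s \<in> bars (F B)"
  obtains i j where "s = {i, j}"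
proof -
  have "\<exists>i j. brace_bar e = {i, j}" for e
    by (cases e rule: brace_bar.cases) auto
  then have "\<exists>i j. s = {i, j}"
    using assms unfolding bars_F grid_bars_def by blast
  then show ?thesis using that by blast
qed

lemma bar_in_joints:
  assumes B: "B \<subseteq> max_braces m n" and "{i, j} \<in> bars (F B)"
  shows "i \<in> {0..m} \<times> {0..n}" "j \<in> {0..m} \<times> {0..n}" "i \<noteq> j"
proof -
  have brace: "\<exists>a b. brace_bar e = {a, b} \<and> a \<noteq> b \<and> {a, b} \<subseteq> {0..m} \<times> {0..n}" if "e \<in> B" for e
  proof -
    obtain j k c where e: "e = (j, k, c)" by (cases e)
    have "j < m" "k < n" using that B by (auto simp: e max_braces_def)
    show ?thesis
    proof (cases c)
      case Blue
      with \<open>j < m\<close> \<open>k < n\<close> show ?thesis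
        by (intro exI[of _ "(j, k + 1)"] exI[of _ "(j + 1, k)"]) (simp add: e)
    next
      case Red
      with \<open>j < m\<close> \<open>k < n\<close> show ?thesis
        by (intro exI[of _ "(j, k)"] exI[of _ "(j + 1, k + 1)"]) (simp add: e)
    qed
  qed
  have "\<exists>a b. {i, j} = {a, b} \<and> a \<noteq> b \<and> {a, b} \<subseteq> {0..m} \<times> {0..n}"
    using assms(2) unfolding bars_F
  proof
    assume "{i, j} \<in> grid_bars m n"
    then consider j' k' where "{i, j} = {(j', k'), (j' + 1, k')}" "j' < m" "k' \<le> n"
      | j' k' where "{i, j} = {(j', k'), (j', k' + 1)}" "j' \<le> m" "k' < n"
      unfolding grid_bars_def by blast
    then show ?thesis
    proof cases
      case 1
      then show ?thesis by (intro exI[of _ "(j', k')"] exI[of _ "(j' + 1, k')"]) auto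
    next
      case 2
      then show ?thesis by (intro exI[of _ "(j', k')"] exI[of _ "(j', k' + 1)"]) auto
    qed
  next
    assume "{i, j} \<in> brace_bar ` B"
    then obtain e where "e \<in> B" "{i, j} = brace_bar e" by (rule imageE)
    with brace[of e] show ?thesis by simp
  qed
  then obtain a b where "{i, j} = {a, b}" "a \<noteq> b" "a \<in> {0..m} \<times> {0..n}" "b \<in> {0..m} \<times> {0..n}"
    by blast
  then show "i \<in> {0..m} \<times> {0..n}" "j \<in> {0..m} \<times> {0..n}" "i \<noteq> j"
    unfolding doubleton_eq_iff by metis+
qed

text \<open>Horizontal and vertical bars are positive multiples of \<open>e1\<close> and
  \<open>e2\<close>, so the irregular spacing survives only in the brace vectors.\<close>

lemma infinitesimal_flex_F_iff:
  assumes B: "B \<subseteq> max_braces m n"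
  shows "infinitesimal_flex N (F B) u \<longleftrightarrow>
    (\<forall>j<m. \<forall>k\<le>n. D e1 (u (j + 1, k) - u (j, k)) = 0) \<and>
    (\<forall>j\<le>m. \<forall>k<n. D e2 (u (j, k + 1) - u (j, k)) = 0) \<and>
    (\<forall>e\<in>B. D (brace_vector x y e) (brace_diff u e) = 0)"
proof -
  let ?P = "placement (F B)"
  \<comment> \<open>Gathers the conditions for both orientations of a bar, so that the quantifier
    can range over bars as sets.\<close>
  define Q where "Q s \<longleftrightarrow> (\<forall>i j. {i, j} = s \<longrightarrow> D (?P i - ?P j) (u i - u j) = 0)" for s
  have Q: "Q {a, b} \<longleftrightarrow> D (?P b - ?P a) (u b - u a) = 0" if "?P a \<noteq> ?P b" for a b
    unfolding Q_def by (rule D_doubleton_iff[of ?P, OF that])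
  have grid: "(\<forall>s\<in>grid_bars m n. Q s) \<longleftrightarrow>
      (\<forall>j<m. \<forall>k\<le>n. Q {(j, k), (j + 1, k)}) \<and> (\<forall>j\<le>m. \<forall>k<n. Q {(j, k), (j, k + 1)})"
    unfolding grid_bars_def ball_Un by (intro arg_cong2[where f = "(\<and>)"]) auto
  have "?P i \<noteq> ?P j" if "{i, j} \<in> bars (F B)" for i j
    using bar_in_joints[OF B that] inj_on_placement_F by (auto dest: inj_onD)
  then have "infinitesimal_flex N (F B) u \<longleftrightarrow> (\<forall>s\<in>bars (F B). Q s)"
    by (subst infinitesimal_flex_iff) (auto simp: Q_def)
  also have "\<dots> \<longleftrightarrow> (\<forall>j<m. \<forall>k\<le>n. Q {(j, k), (j + 1, k)}) \<and>
      (\<forall>j\<le>m. \<forall>k<n. Q {(j, k), (j, k + 1)}) \<and> (\<forall>e\<in>B. Q (brace_bar e))"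
    unfolding bars_F ball_Un grid by (simp only: conj_assoc ball_simps)
  also have "(\<forall>j<m. \<forall>k\<le>n. Q {(j, k), (j + 1, k)}) \<longleftrightarrow> (\<forall>j<m. \<forall>k\<le>n. D e1 (u (j + 1, k) - u (j, k)) = 0)"
  proof (intro iff_allI imp_cong refl)
    fix j k assume "j < m"
    have P: "?P (j + 1, k) - ?P (j, k) = (x (j + 1) - x j) *\<^sub>R e1"
      by (simp add: placement_F vec_eq_iff forall_2)
    with x_less[OF \<open>j < m\<close>] e1_neq_0 have "?P (j, k) \<noteq> ?P (j + 1, k)"
      by (metis diff_self diff_gt_0_iff_gt less_irrefl scaleR_eq_0_iff)
    from Q[OF this] show "Q {(j, k), (j + 1, k)} \<longleftrightarrow> D e1 (u (j + 1, k) - u (j, k)) = 0"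
      unfolding P using D_scale[OF e1_neq_0] x_less[OF \<open>j < m\<close>] by simp
  qed
  also have "(\<forall>j\<le>m. \<forall>k<n. Q {(j, k), (j, k + 1)}) \<longleftrightarrow> (\<forall>j\<le>m. \<forall>k<n. D e2 (u (j, k + 1) - u (j, k)) = 0)"
  proof (intro iff_allI imp_cong refl)
    fix j k assume "k < n"
    have P: "?P (j, k + 1) - ?P (j, k) = (y (k + 1) - y k) *\<^sub>R e2"
      by (simp add: placement_F vec_eq_iff forall_2)
    with y_less[OF \<open>k < n\<close>] e2_neq_0 have "?P (j, k) \<noteq> ?P (j, k + 1)"
      by (metis diff_self diff_gt_0_iff_gt less_irrefl scaleR_eq_0_iff)
    from Q[OF this] show "Q {(j, k), (j, k + 1)} \<longleftrightarrow> D e2 (u (j, k + 1) - u (j, k)) = 0"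
      unfolding P using D_scale[OF e2_neq_0] y_less[OF \<open>k < n\<close>] by simp
  qed
  also have "(\<forall>e\<in>B. Q (brace_bar e)) \<longleftrightarrow> (\<forall>e\<in>B. D (brace_vector x y e) (brace_diff u e) = 0)"
  proof (rule ball_cong[OF refl])
    fix e assume "e \<in> B"
    obtain j k c where e: "e = (j, k, c)" by (cases e)
    have "j < m" using \<open>e \<in> B\<close> B by (auto simp: e max_braces_def)
    then have "brace_vector x y e $ 1 \<noteq> 0" using x_less[of j] by (cases c) (simp_all add: e)
    then have e0: "brace_vector x y e \<noteq> 0" by auto
    show "Q (brace_bar e) \<longleftrightarrow> D (brace_vector x y e) (brace_diff u e) = 0"
    proof (cases c)
      case Blue
      have P: "?P (j + 1, k) - ?P (j, k + 1) = brace_vector x y e"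
        by (simp add: placement_F e Blue vec_eq_iff forall_2)
      with e0 have "?P (j, k + 1) \<noteq> ?P (j + 1, k)" by (metis diff_self)
      from Q[OF this] show ?thesis unfolding P by (simp add: e Blue)
    next
      case Red
      have P: "?P (j + 1, k + 1) - ?P (j, k) = brace_vector x y e"
        by (simp add: placement_F e Red vec_eq_iff forall_2)
      with e0 have "?P (j, k) \<noteq> ?P (j + 1, k + 1)" by (metis diff_self)
      from Q[OF this] show ?thesis unfolding P by (simp add: e Red)
    qed
  qed
  finally show ?thesis .
qed

section \<open>Correspondence of flexes and potentials\<close>

lemma tangents_coeffs_eq:
  assumes "s *\<^sub>R ux + r *\<^sub>R uy = s' *\<^sub>R ux + r' *\<^sub>R uy"
  shows "s = s'" "r = r'"
proof -
  have "(s - s') * ux $ i + (r - r') * uy $ i = 0" for i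
    using arg_cong[OF assms, of "\<lambda>v. v $ i"] by (simp add: algebra_simps)
  from this[of 1] this[of 2]
  have "(s - s') * (ux $ 1 * uy $ 2 - ux $ 2 * uy $ 1) = 0" "(r - r') * (ux $ 1 * uy $ 2 - ux $ 2 * uy $ 1) = 0"
    by algebra+
  with tangents_not_parallel show "s = s'" "r = r'" by auto
qed

text \<open>\<open>f\<close> records \<open>u\<close> up to translation: \<open>uy\<close> and
  \<open>ux\<close> span the kernels of \<open>D e1\<close> and \<open>D e2\<close>. The minus sign
  at rows makes the condition of a brace of either colour an equation with a positive gain.\<close>

definition steps :: "(nat \<times> nat \<Rightarrow> real^2) \<Rightarrow> (braces_vertex \<Rightarrow> real) \<Rightarrow> bool" where
  "steps u f \<longleftrightarrow>
    (\<forall>j<m. \<forall>k\<le>n. u (j + 1, k) - u (j, k) = f (Col j) *\<^sub>R uy) \<and>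
    (\<forall>j\<le>m. \<forall>k<n. u (j, k + 1) - u (j, k) = - f (Row k) *\<^sub>R ux)"

lemma stepsD:
  assumes "steps u f"
  shows "j < m \<Longrightarrow> k \<le> n \<Longrightarrow> u (j + 1, k) - u (j, k) = f (Col j) *\<^sub>R uy"
    and "j \<le> m \<Longrightarrow> k < n \<Longrightarrow> u (j, k + 1) - u (j, k) = - f (Row k) *\<^sub>R ux"
  using assms unfolding steps_def by blast+

text \<open>The two ways around a cell from its lower left to its upper right corner give the same
  sum. As \<open>ux\<close> and \<open>uy\<close> are independent, opposite sides have equal
  coefficients, which are then constant along a column or a row of cells.\<close>

lemma exists_steps_if_grid_flex:
  assumes h: "\<And>j k. j < m \<Longrightarrow> k \<le> n \<Longrightarrow> D e1 (u (j + 1, k) - u (j, k)) = 0"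
    and v: "\<And>j k. j \<le> m \<Longrightarrow> k < n \<Longrightarrow> D e2 (u (j, k + 1) - u (j, k)) = 0"
  shows "\<exists>f. steps u f"
proof -
  have "\<exists>a. u (j + 1, k) - u (j, k) = a *\<^sub>R uy" if "j < m" "k \<le> n" for j k
    using kernel_D_parallel[OF e1_neq_0 tangent_y(1,3) h[OF that]] by metis
  then obtain a where a: "\<And>j k. j < m \<Longrightarrow> k \<le> n \<Longrightarrow> u (j + 1, k) - u (j, k) = a j k *\<^sub>R uy"
    by metis
  have "\<exists>b. u (j, k + 1) - u (j, k) = b *\<^sub>R ux" if "j \<le> m" "k < n" for j k
    using kernel_D_parallel[OF e2_neq_0 tangent_x(1,3) v[OF that]] by metis
  then obtain b where b: "\<And>j k. j \<le> m \<Longrightarrow> k < n \<Longrightarrow> u (j, k + 1) - u (j, k) = b j k *\<^sub>R ux"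
    by metis
  have cell: "b (j + 1) k = b j k" "a j k = a j (k + 1)" if "j < m" "k < n" for j k
  proof -
    have "(u (j + 1, k + 1) - u (j + 1, k)) + (u (j + 1, k) - u (j, k)) =
        (u (j, k + 1) - u (j, k)) + (u (j + 1, k + 1) - u (j, k + 1))" by simp
    moreover have "u (j + 1, k) - u (j, k) = a j k *\<^sub>R uy" "u (j + 1, k + 1) - u (j, k + 1) = a j (k + 1) *\<^sub>R uy"
      "u (j, k + 1) - u (j, k) = b j k *\<^sub>R ux" "u (j + 1, k + 1) - u (j + 1, k) = b (j + 1) k *\<^sub>R ux"
      using that a[of j k] a[of j "k + 1"] b[of j k] b[of "j + 1" k] by simp_all
    ultimately have "b (j + 1) k *\<^sub>R ux + a j k *\<^sub>R uy = b j k *\<^sub>R ux + a j (k + 1) *\<^sub>R uy"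
      by (simp only:)
    then show "b (j + 1) k = b j k" "a j k = a j (k + 1)" by (rule tangents_coeffs_eq)+
  qed
  have a0: "a j k = a j 0" if "j < m" "k \<le> n" for j k
    using that(2) by (induction k) (use cell(2)[OF that(1)] in auto)
  have b0: "b j k = b 0 k" if "j \<le> m" "k < n" for j k
    using that(1) by (induction j) (use cell(1)[OF _ that(2)] in auto)
  have "steps u (\<lambda>w. case w of Col j \<Rightarrow> a j 0 | Row k \<Rightarrow> - b 0 k)"
    unfolding steps_def
  proof (intro conjI allI impI)
    fix j k
    show "u (j + 1, k) - u (j, k) = (case Col j of Col j \<Rightarrow> a j 0 | Row k \<Rightarrow> - b 0 k) *\<^sub>R uy"
      if "j < m" "k \<le> n"
      using a[OF that] a0[OF that] by simp
    show "u (j, k + 1) - u (j, k) = - (case Row k of Col j \<Rightarrow> a j 0 | Row k \<Rightarrow> - b 0 k) *\<^sub>R ux"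
      if "j \<le> m" "k < n"
      using b[OF that] b0[OF that] by simp
  qed
  then show ?thesis by blast
qed

lemma exists_steps: "\<exists>u. steps u f"
proof -
  have "steps (\<lambda>(j, k). (\<Sum>i<j. f (Col i)) *\<^sub>R uy - (\<Sum>i<k. f (Row i)) *\<^sub>R ux) f"
    by (simp add: steps_def algebra_simps)
  then show ?thesis by blast
qed

text \<open>Steps satisfy the conditions of all grid bars by construction. Along a brace they add up
  to a multiple of \<open>uy\<close> plus or minus a multiple of \<open>ux\<close>, which is the
  form treated by the brace parameter.\<close>

lemma infinitesimal_flex_F_iff_potential:
  assumes B: "B \<subseteq> max_braces m n" and u: "steps u f"
  shows "infinitesimal_flex N (F B) u \<longleftrightarrow> potential l B f"
proof -
  have "D e1 (u (j + 1, k) - u (j, k)) = 0" if "j < m" "k \<le> n" for j k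
    using u that tangent_y(3) linear_scale[OF linear_D[OF e1_neq_0]] by (simp add: steps_def)
  moreover have "D e2 (u (j, k + 1) - u (j, k)) = 0" if "j \<le> m" "k < n" for j k
    using u that tangent_x(3) linear_neg[OF linear_D[OF e2_neq_0]] linear_scale[OF linear_D[OF e2_neq_0]]
    by (simp add: steps_def)
  moreover have "D (brace_vector x y (j, k, c)) (brace_diff u (j, k, c)) = 0
      \<longleftrightarrow> f (Row k) = l (j, k, c) * f (Col j)" if "(j, k, c) \<in> B" for j k c
  proof -
    have jk: "j < m" "k < n" using that B by (auto simp: max_braces_def)
    then have h: "u (j + 1, k) = u (j, k) + f (Col j) *\<^sub>R uy"
      and v: "u (j, k + 1) = u (j, k) - f (Row k) *\<^sub>R ux"
      and hv: "u (j + 1, k + 1) = u (j + 1, k) - f (Row k) *\<^sub>R ux"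
      using u by (auto simp: steps_def algebra_simps)
    have "brace_diff u (j, k, c) = f (Col j) *\<^sub>R uy + (colour_sign (j, k, c) * f (Row k)) *\<^sub>R ux"
      using h v hv by (cases c) (simp_all add: algebra_simps)
    with D_brace_vector_eq_0_iff[OF x_less[OF jk(1)] y_less[OF jk(2)]] show ?thesis by simp
  qed
  ultimately show ?thesis
    unfolding infinitesimal_flex_F_iff[OF B] potential_def by (simp add: Ball_def split_paired_All)
qed

lemma exists_potential_if_flex:
  assumes B: "B \<subseteq> max_braces m n" and "infinitesimal_flex N (F B) u"
  shows "\<exists>f. potential l B f \<and> steps u f"
proof -
  obtain f where "steps u f"
    using assms(2) exists_steps_if_grid_flex[of u] unfolding infinitesimal_flex_F_iff[OF B] by blast
  with assms(2) infinitesimal_flex_F_iff_potential[OF B this] show ?thesis by blast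
qed

lemma steps_unique:
  assumes u: "steps u f" and v: "steps v g" and eq: "\<And>i. i \<in> {0..m} \<times> {0..n} \<Longrightarrow> u i = v i"
  shows "j < m \<Longrightarrow> f (Col j) = g (Col j)" "k < n \<Longrightarrow> f (Row k) = g (Row k)"
proof -
  assume j: "j < m"
  have "f (Col j) *\<^sub>R uy = u (j + 1, 0) - u (j, 0)" by (rule stepsD(1)[OF u j, symmetric]) simp
  also have "\<dots> = v (j + 1, 0) - v (j, 0)" using j by (simp add: eq)
  also have "\<dots> = g (Col j) *\<^sub>R uy" by (rule stepsD(1)[OF v j]) simp
  finally show "f (Col j) = g (Col j)" using tangent_y(1) by simp
next
  assume k: "k < n"
  have "- f (Row k) *\<^sub>R ux = u (0, k + 1) - u (0, k)" by (rule stepsD(2)[OF u _ k, symmetric]) simp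
  also have "\<dots> = v (0, k + 1) - v (0, k)" using k by (simp add: eq)
  also have "\<dots> = - g (Row k) *\<^sub>R ux" by (rule stepsD(2)[OF v _ k]) simp
  finally show "f (Row k) = g (Row k)" using tangent_x(1) by simp
qed

lemma const_if_steps_0:
  assumes u: "steps u f" and f: "\<And>j. j < m \<Longrightarrow> f (Col j) = 0" "\<And>k. k < n \<Longrightarrow> f (Row k) = 0"
    and "j \<le> m" "k \<le> n"
  shows "u (j, k) = u (0, 0)"
proof -
  have "u (i + 1, k) = u (i, k)" if "i < m" for i
    using stepsD(1)[OF u that \<open>k \<le> n\<close>] f(1)[OF that] by simp
  then have "u (j, k) = u (0, k)" using \<open>j \<le> m\<close> by (induction j) auto
  also have "u (0, i + 1) = u (0, i)" if "i < n" for i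
    using stepsD(2)[OF u _ that, of 0] f(2)[OF that] by simp
  then have "u (0, k) = u (0, 0)" using \<open>k \<le> n\<close> by (induction k) auto
  finally show ?thesis .
qed

section \<open>Rigidity and rigid motion flexes\<close>

lemma infinitesimal_flex_const: "infinitesimal_flex N F' (\<lambda>_. c)"
  by (simp add: infinitesimal_flex_def)

text \<open>A flex with zero steps is constant on the joints, and a constant extends to every
  containing framework. The larger set \<open>B'\<close> allows one statement to serve both
  \<open>B\<close> itself and the set of all braces.\<close>

lemma infinitesimally_rigid_if_potentials_eq_0:
  assumes B: "B \<subseteq> B'" "B' \<subseteq> max_braces m n"
    and zero: "\<And>f v. potential l B f \<Longrightarrow> v \<in> verts (doubled_complete_bipartite m n) \<Longrightarrow> f v = 0"
  shows "infinitesimally_rigid N (F B')"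
  unfolding infinitesimally_rigid_def
proof (intro allI impI)
  fix u assume u: "infinitesimal_flex N (F B') u"
  then obtain f where f: "potential l B' f" "steps u f"
    using exists_potential_if_flex[OF B(2)] by blast
  have "potential l B f" using f(1) B(1) by (auto simp: potential_def)
  from zero[OF this] have "f (Col j) = 0" if "j < m" for j
    using that by (simp add: doubled_complete_bipartite_def)
  moreover from zero[OF \<open>potential l B f\<close>] have "f (Row k) = 0" if "k < n" for k
    using that by (simp add: doubled_complete_bipartite_def)
  ultimately have const: "u (j, k) = u (0, 0)" if "j \<le> m" "k \<le> n" for j k
    using const_if_steps_0[OF f(2)] that by blast
  have "u (0, 0) = u i" if "i \<in> joints (F B')" for i
    using const[of "fst i" "snd i"] that by (simp add: joints_F mem_Times_iff)
  then show "rigid_motion_flex N (F B') u"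
    unfolding rigid_motion_flex_def using u infinitesimal_flex_const[of _ "u (0, 0)"] by blast
qed

text \<open>Extendability is applied to one containing framework, in which a lattice spanned by the
  sides of the cell \<open>(0, 0)\<close> is added and all pairs at different positions are joined.
  The extended flex is affine on the lattice, and its linear part is a tangent field, injective
  because both steps are nonzero.\<close>

lemma euclidean_norm_if_rigid_motion:
  assumes B: "B \<subseteq> max_braces m n" and rm: "rigid_motion_flex N (F B) u"
    and f: "steps u f" "f (Col 0) \<noteq> 0" "f (Row 0) \<noteq> 0"
  shows "euclidean_norm N"
proof -
  define h where "h = x 1 - x 0"
  define v where "v = y 1 - y 0"
  have hv: "0 < h" "0 < v" using x_less[of 0] y_less[of 0] m n by (simp_all add: h_def v_def)
  (* Indices j > m are free for a lattice. It is shifted by (h, v) so that no vector from a corner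
     of the cell (0, 0) to a lattice point is parallel to an axis, as the parallelogram rule needs. *)
  define P :: "nat \<times> nat \<Rightarrow> real^2" where
    "P = (\<lambda>(j, k). if j \<le> m then vector [x j, y k]
       else vector [x 0 + real (j - m) * h, y 0 + real (k + 1) * v])"
  \<comment> \<open>Different joints may share a position: the lattice joint
    \<open>(m + 1, 0)\<close> lies on the grid joint \<open>(1, 1)\<close>. Bars are therefore
    restricted to pairs with different positions.\<close>
  define F' :: "(nat \<times> nat) framework" where
    "F' = \<lparr>joints = UNIV, bars = {{i, j} | i j. P i \<noteq> P j}, placement = P\<rparr>"
  have "wf_framework F'" by (auto simp: wf_framework_def F'_def card_2_iff)
  moreover have "contains_framework F' (F B)"
  proof -
    have P: "placement F' i = placement (F B) i" if "i \<in> {0..m} \<times> {0..n}" for i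
      using that by (auto simp: F'_def P_def braced_grid_def)
    have "s \<in> bars F'" if s: "s \<in> bars (F B)" for s
    proof -
      obtain i j where ij: "s = {i, j}" using bar_is_doubleton[OF s] .
      note b = bar_in_joints[OF B s[unfolded ij]]
      then have "placement (F B) i \<noteq> placement (F B) j"
        using inj_onD[OF inj_on_placement_F] by blast
      then have "P i \<noteq> P j" using P[OF b(1)] P[OF b(2)] by (simp add: F'_def)
      moreover have "bars F' = {{i, j} | i j. P i \<noteq> P j}" by (simp add: F'_def)
      ultimately show ?thesis unfolding ij by blast
    qed
    then show ?thesis using P by (auto simp: contains_framework_def F'_def joints_F)
  qed
  ultimately obtain u' where u': "infinitesimal_flex N F' u'" "\<And>i. i \<in> {0..m} \<times> {0..n} \<Longrightarrow> u' i = u i"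
    using rm unfolding rigid_motion_flex_def joints_F by blast
  have bars: "{i, j} \<in> bars F' \<longleftrightarrow> P i \<noteq> P j" for i j
  proof -
    have F': "bars F' = {{i, j} | i j. P i \<noteq> P j}" by (simp add: F'_def)
    show ?thesis
    proof
      assume "{i, j} \<in> bars F'"
      then obtain i' j' where "{i, j} = {i', j'}" "P i' \<noteq> P j'" unfolding F' by blast
      then show "P i \<noteq> P j" unfolding doubleton_eq_iff by metis
    qed (unfold F', blast)
  qed
  have placement: "placement F' = P" by (simp add: F'_def)
  have tangent: "D (P i - P j) (u' i - u' j) = 0" if "P i \<noteq> P j" for i j
  proof -
    have "infinitesimal_flex N F' u' \<longleftrightarrow> (\<forall>i j. P i \<noteq> P j \<longrightarrow> D (P i - P j) (u' i - u' j) = 0)"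
      by (subst infinitesimal_flex_iff, unfold bars placement) (assumption, rule refl)
    with u'(1) that show ?thesis by blast
  qed
  define A where "A = u (1, 0) - u (0, 0)"
  define C where "C = u (0, 1) - u (0, 0)"
  have A: "A = f (Col 0) *\<^sub>R uy" using stepsD(1)[OF f(1), of 0 0] m by (simp add: A_def)
  have C: "C = - f (Row 0) *\<^sub>R ux" using stepsD(2)[OF f(1), of 0 0] n by (simp add: C_def)
  \<comment> \<open>The joint \<open>(m + 1 + i, k)\<close> lies \<open>i + 1\<close> steps to the
    right of the corner \<open>(0, 0)\<close> and \<open>k + 1\<close> steps above it.\<close>
  define U where "U i k = u' (m + 1 + i, k)" for i k
  have PU: "P (m + 1 + i, k) = vector [x 0 + real (i + 1) * h, y 0 + real (k + 1) * v]" for i k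
    by (simp add: P_def)
  have P0: "P (0, 0) = vector [x 0, y 0]" "P (1, 0) = vector [x 0 + h, y 0]" "P (0, 1) = vector [x 0, y 0 + v]"
    using m by (simp_all add: P_def h_def v_def)
  have u0: "u' (0, 0) = u (0, 0)" "u' (1, 0) = u (1, 0)" "u' (0, 1) = u (0, 1)"
    using u'(2) m n by auto
  have stepA: "U (i + 1) k = U i k + A" for i k
  proof -
    \<comment> \<open>The bottom side of the cell \<open>(0, 0)\<close> is opposite to a lattice
      segment in a parallelogram of positive height, so it carries its step \<open>A\<close> to the
      lattice.\<close>
    have "u' (1, 0) - u' (0, 0) = u' (m + 1 + (i + 1), k) - u' (m + 1 + i, k)"
    proof (rule parallelogram[where P = P and u = u' and d = "vector [h, 0]"
          and e = "vector [real (i + 1) * h, real (k + 1) * v]"])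
      show "P (1, 0) - P (0, 0) = vector [h, 0]"
        "P (m + 1 + (i + 1), k) - P (m + 1 + i, k) = vector [h, 0]"
        "P (m + 1 + i, k) - P (0, 0) = vector [real (i + 1) * h, real (k + 1) * v]"
        "P (m + 1 + (i + 1), k) - P (1, 0) = vector [real (i + 1) * h, real (k + 1) * v]"
        unfolding PU P0 by (simp_all add: vec_eq_iff forall_2 algebra_simps)
      have "real (k + 1) * v \<noteq> 0" using hv by (simp del: of_nat_Suc of_nat_add)
      then show "(vector [h, 0] :: real^2) $ 1 * (vector [real (i + 1) * h, real (k + 1) * v] :: real^2) $ 2
          \<noteq> (vector [h, 0] :: real^2) $ 2 * (vector [real (i + 1) * h, real (k + 1) * v] :: real^2) $ 1"
        using hv by simp
    qed (rule tangent)
    then show ?thesis unfolding u0 by (simp add: U_def A_def algebra_simps)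
  qed
  have stepC: "U i (k + 1) = U i k + C" for i k
  proof -
    have "u' (0, 1) - u' (0, 0) = u' (m + 1 + i, k + 1) - u' (m + 1 + i, k)"
    proof (rule parallelogram[where P = P and u = u' and d = "vector [0, v]"
          and e = "vector [real (i + 1) * h, real (k + 1) * v]"])
      show "P (0, 1) - P (0, 0) = vector [0, v]"
        "P (m + 1 + i, k + 1) - P (m + 1 + i, k) = vector [0, v]"
        "P (m + 1 + i, k) - P (0, 0) = vector [real (i + 1) * h, real (k + 1) * v]"
        "P (m + 1 + i, k + 1) - P (0, 1) = vector [real (i + 1) * h, real (k + 1) * v]"
        unfolding PU P0 by (simp_all add: vec_eq_iff forall_2 algebra_simps)
      have "real (i + 1) * h \<noteq> 0" using hv by (simp del: of_nat_Suc of_nat_add)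
      then show "(vector [0, v] :: real^2) $ 1 * (vector [real (i + 1) * h, real (k + 1) * v] :: real^2) $ 2
          \<noteq> (vector [0, v] :: real^2) $ 2 * (vector [real (i + 1) * h, real (k + 1) * v] :: real^2) $ 1"
        using hv by simp
    qed (rule tangent)
    then show ?thesis unfolding u0 by (simp add: U_def C_def algebra_simps)
  qed
  have "U i k = U 0 k + real i *\<^sub>R A" for i k
    by (induction i) (use stepA in \<open>simp_all add: algebra_simps\<close>)
  moreover have "U 0 k = U 0 0 + real k *\<^sub>R C" for k
    by (induction k) (use stepC in \<open>simp_all add: algebra_simps\<close>)
  ultimately have U: "U i k = U 0 0 + real k *\<^sub>R C + real i *\<^sub>R A" for i k by metis
  define L where "L w = (w $ 1 / h) *\<^sub>R A + (w $ 2 / v) *\<^sub>R C" for w :: "real^2"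
  have L: "linear L"
    by (rule linearI) (simp_all add: L_def algebra_simps add_divide_distrib)
  have lattice: "D (vector [real_of_int a * h, real_of_int b * v]) (L (vector [real_of_int a * h, real_of_int b * v])) = 0"
    if ab: "a \<noteq> 0 \<or> b \<noteq> 0" for a b
  proof -
    \<comment> \<open>Lattice joints have natural indices only, so a lattice vector with negative
      entries is written as a difference of two of them.\<close>
    define i i' k k' where "i = nat a" and "i' = nat (- a)" and "k = nat b" and "k' = nat (- b)"
    have ik: "real_of_int a = real i - real i'" "real_of_int b = real k - real k'"
      by (simp_all add: i_def i'_def k_def k'_def)
    have P: "P (m + 1 + i, k) - P (m + 1 + i', k') = vector [real_of_int a * h, real_of_int b * v]"
      unfolding PU ik by (simp add: vec_eq_iff forall_2 algebra_simps)
    also have "\<dots> \<noteq> 0" using ab hv by (auto simp: vec_eq_iff forall_2)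
    finally have "P (m + 1 + i, k) \<noteq> P (m + 1 + i', k')" by simp
    from tangent[OF this] have "D (vector [real_of_int a * h, real_of_int b * v]) (U i k - U i' k') = 0"
      unfolding P U_def .
    also have "U i k - U i' k' = L (vector [real_of_int a * h, real_of_int b * v])"
    proof -
      have "L (vector [real_of_int a * h, real_of_int b * v]) = (real i - real i') *\<^sub>R A + (real k - real k') *\<^sub>R C"
        using hv by (simp add: L_def ik)
      then show ?thesis unfolding U[of i k] U[of i' k'] by (simp add: algebra_simps)
    qed
    finally show ?thesis .
  qed
  show ?thesis
  proof (rule euclidean_norm_if_linear_tangent_field[OF L])
    show "D p (L p) = 0" if "p \<noteq> 0" for p
      by (rule linear_tangent_field_if_on_lattice[OF hv L lattice that])
    show "w = 0" if "L w = 0" for w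
    proof -
      have "(- (w $ 2 / v * f (Row 0))) *\<^sub>R ux + (w $ 1 / h * f (Col 0)) *\<^sub>R uy = 0 *\<^sub>R ux + 0 *\<^sub>R uy"
        using that by (simp add: L_def A C algebra_simps)
      from tangents_coeffs_eq[OF this] have "w $ 1 = 0" "w $ 2 = 0" using f(2,3) hv by auto
      then show ?thesis by (simp add: vec_eq_iff forall_2)
    qed
  qed
qed

text \<open>With all braces present, every column is adjacent to every row by an edge of positive
  gain, so a single zero would spread to all vertices.\<close>

lemma potential_max_braces_nonzero:
  assumes f: "potential l (max_braces m n) f"
    and v: "v \<in> verts (doubled_complete_bipartite m n)" "f v \<noteq> 0"
  shows "f (Col 0) \<noteq> 0" "f (Row 0) \<noteq> 0"
proof -
  have eq: "f (Row k) = 0 \<longleftrightarrow> f (Col j) = 0" if "j < m" "k < n" for j k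
  proof -
    have "f (Row k) = l (j, k, Red) * f (Col j)"
      using f that by (simp add: potential_def max_braces_def)
    moreover have "0 < l (j, k, Red)"
      using brace_parameter_pos[OF x_less[OF that(1)] y_less[OF that(2)]] .
    ultimately show ?thesis by simp
  qed
  consider j where "v = Col j" "j < m" | k where "v = Row k" "k < n"
    using v(1) by (auto simp: doubled_complete_bipartite_def)
  then have "f (Col 0) \<noteq> 0 \<and> f (Row 0) \<noteq> 0"
  proof cases
    case 1
    then show ?thesis using eq[of j 0] eq[of 0 0] m n v(2) by simp
  next
    case 2
    then show ?thesis using eq[of 0 k] eq[of 0 0] m n v(2) by simp
  qed
  then show "f (Col 0) \<noteq> 0" "f (Row 0) \<noteq> 0" by auto
qed

text \<open>A nonzero potential on \<open>B\<close> gives a flex, which by rigidity extends to the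
  grid with all braces. Its steps on the grid are unchanged, so \<open>f\<close> agrees on the
  vertices with a potential \<open>g\<close> for all braces and is nonzero at both
  \<open>Col 0\<close> and \<open>Row 0\<close>. This makes the norm Euclidean.\<close>

lemma potential_eq_0_if_infinitesimally_rigid:
  assumes ne: "\<not> euclidean_norm N" and B: "B \<subseteq> max_braces m n"
    and rigid: "infinitesimally_rigid N (F B)"
    and f: "potential l B f" and v: "v \<in> verts (doubled_complete_bipartite m n)"
  shows "f v = 0"
proof (rule ccontr)
  assume fv: "f v \<noteq> 0"
  obtain u where u: "steps u f" using exists_steps by blast
  then have "infinitesimal_flex N (F B) u" using infinitesimal_flex_F_iff_potential[OF B] f by blast
  then have rm: "rigid_motion_flex N (F B) u" using rigid by (simp add: infinitesimally_rigid_def)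
  have "wf_framework (F (max_braces m n))"
    unfolding wf_framework_def
  proof
    fix s assume s: "s \<in> bars (F (max_braces m n))"
    then obtain i j where ij: "s = {i, j}" by (rule bar_is_doubleton)
    from bar_in_joints[OF order_refl s[unfolded ij]]
    show "s \<subseteq> joints (F (max_braces m n)) \<and> card s = 2" by (simp add: ij joints_F)
  qed
  moreover have "contains_framework (F (max_braces m n)) (F B)"
    using B by (auto simp: contains_framework_def braced_grid_def)
  ultimately obtain u' where u': "infinitesimal_flex N (F (max_braces m n)) u'"
      "\<And>i. i \<in> {0..m} \<times> {0..n} \<Longrightarrow> u' i = u i"
    using rm unfolding rigid_motion_flex_def joints_F by blast
  then obtain g where g: "potential l (max_braces m n) g" "steps u' g"
    using exists_potential_if_flex[OF order_refl] by blast
  note fg = steps_unique[OF g(2) u u'(2)]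
  have "g v = f v" using v fg by (auto simp: doubled_complete_bipartite_def)
  with fv have "g (Col 0) \<noteq> 0" "g (Row 0) \<noteq> 0" using potential_max_braces_nonzero[OF g(1) v] by auto
  then have "f (Col 0) \<noteq> 0" "f (Row 0) \<noteq> 0" using fg(1)[of 0] fg(2)[of 0] m n by auto
  with euclidean_norm_if_rigid_motion[OF B rm u] ne show False by blast
qed

end

theorem mainTheorem2:
  fixes N :: "real^2 \<Rightarrow> real"
    and m n :: nat
    and x y :: "nat \<Rightarrow> real"
    and B :: "brace set"
  assumes "1 \<le> m" and "1 \<le> n"
    and "norm_on_plane N"
    and "differentiable_norm N"
    and "strictly_convex_norm N"
    and "\<not> euclidean_norm N"
    and "strict_mono_on {0..m} x"
    and "strict_mono_on {0..n} y"
    and "B \<subseteq> max_braces m n"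
  shows "infinitesimally_rigid N (braced_grid m n x y B) \<longleftrightarrow>
           infinitesimally_rigid N (braced_grid m n x y (max_braces m n)) \<and>
           spanning (braces_graph B) (doubled_complete_bipartite m n) \<and>
           (\<forall>H \<in> pre_digraph.sccs (braces_graph B).
              \<exists>c. independent_cycle (brace_parameter N x y) H c)"
    (is "?rigid \<longleftrightarrow> ?max \<and> ?span \<and> ?cycles")
proof -
  interpret grid N m n x y
    by unfold_locales (use assms in auto)
  note B = assms(9)
  have pos: "0 < l e" if "e \<in> B" for e
  proof -
    obtain j k c where e: "e = (j, k, c)" by (cases e)
    have "j < m" "k < n" using that B by (auto simp: e max_braces_def)
    then show ?thesis unfolding e by (intro brace_parameter_pos x_less y_less)
  qed
  show ?thesis
  proof
    assume ?rigid
    \<comment> \<open>All three parts of (ii) follow from the vanishing of the potentials on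
      \<open>B\<close>.\<close>
    note zero = potential_eq_0_if_infinitesimally_rigid[OF assms(6) B this]
    have ?max by (rule infinitesimally_rigid_if_potentials_eq_0[OF B order_refl], rule zero)
    moreover have ?span by (rule spanning_if_potentials_eq_0[OF B], rule zero)
    moreover have ?cycles
      by (intro ballI, rule independent_cycle_if_potentials_eq_0[OF B pos], assumption, rule zero)
    ultimately show "?max \<and> ?span \<and> ?cycles" by blast
  next
    assume *: "?max \<and> ?span \<and> ?cycles"
    show ?rigid
      by (rule infinitesimally_rigid_if_potentials_eq_0[OF order_refl B],
        rule potential_eq_0[OF B pos]) (use * in blast)+
  qed
qed

end
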